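(* Let $n \geq 1$ and let $P$ be a set of $n$ red points and either $n$ or $n-1$ blue points in the Euclidean plane. If $P$ is neither collinear nor a near-pencil, then $P$ determines at least $|P|-1$ bichromatic lines.
   Context: All points of $P$ are distinct, and each point has exactly one of the two colours red, blue. A line is determined by $P$ if it contains at least two points of $P$. A bichromatic line is a line containing at least one red point and at least one blue point of $P$. A set of points is collinear if it is contained in a line. $P$ is a near-pencil if it is not collinear but all points of $P$ except exactly one lie on a common line. *)

theory Defs
  imports "HOL-Analysis.Analysis"
begin

definition is_line :: "(real^2) set \<Rightarrow> bool" where
  "is_line L \<longleftrightarrow> affine L \<and> aff_dim L = 1"

definition determined_by :: "(real^2) set \<Rightarrow> (real^2) set \<Rightarrow> bool" where
  "determined_by P L \<longleftrightarrow> is_line L \<and> (\<exists>p\<in>P \<inter> L. \<exists>q\<in>P \<inter> L. p \<noteq> q)"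

(* R is the set of red points, B the set of blue points. *)
definition bichromatic :: "(real^2) set \<Rightarrow> (real^2) set \<Rightarrow> (real^2) set \<Rightarrow> bool" where
  "bichromatic R B L \<longleftrightarrow> is_line L \<and> R \<inter> L \<noteq> {} \<and> B \<inter> L \<noteq> {}"

definition near_pencil :: "(real^2) set \<Rightarrow> bool" where
  "near_pencil P \<longleftrightarrow> \<not> collinear P \<and> (\<exists>L. is_line L \<and> card (P - L) = 1)"

(* The library predicate collinear is stated via a common direction vector;
   in the plane it means being contained in a line. *)
lemma collinear_iff_subset_line:
  fixes S :: "(real^2) set"
  shows "collinear S \<longleftrightarrow> (\<exists>L. is_line L \<and> S \<subseteq> L)"
proof
  assume "collinear S"
  then obtain u v where uv: "S \<subseteq> affine hull {u, v}"
    using collinear_affine_hull by blast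
  obtain w :: "real^2" where w: "w \<noteq> u"
    by (metis vector_choose_dist zero_le_one dist_self zero_neq_one)
  define z where "z = (if u = v then w else v)"
  have "z \<noteq> u" using w by (auto simp: z_def)
  then have "is_line (affine hull {u, z})"
    by (simp add: is_line_def aff_dim_2)
  moreover have "affine hull {u, v} \<subseteq> affine hull {u, z}"
    by (rule hull_mono) (auto simp: z_def)
  ultimately show "\<exists>L. is_line L \<and> S \<subseteq> L"
    using uv by blast
next
  assume "\<exists>L. is_line L \<and> S \<subseteq> L"
  then show "collinear S"
    using collinear_aff_dim collinear_subset unfolding is_line_def
    by (metis order_refl)
qed

end

theory Submission
  imports Defs
begin

text \<open>
  The proof is an induction on the number of points in which Melchior's inequality carries the
  geometry.  Write \<open>n\<close> and \<open>b\<close> for the numbers of red and blue points, \<open>N = n + b\<close>, \<open>T\<close> for the number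
  of bichromatic lines, and \<open>i\<close> and \<open>j\<close> for the numbers of red and blue points on a given line; by
  symmetry \<open>b \<in> {n, n - 1}\<close>.

  If some line misses exactly two points, then the lines from these two points to the others, together
  with that line if it is bichromatic, already suffice (\<open>two_points_off_line\<close>).  Otherwise every line misses
  at least three points, so deleting any point leaves a set that is neither collinear nor a near-pencil.  If a red point is the only red point
  on some bichromatic line, then deleting it destroys that line and induction finishes.  So a smallest
  counterexample satisfies \<open>T = N - 2\<close>, every bichromatic line has \<open>i \<ge> 2\<close>, and also \<open>j \<ge> 2\<close> if
  \<open>b = n\<close>.  The locale \<open>tight_colouring\<close> collects these properties and refutes them.

  Melchior's inequality bounds the sum of \<open>i + j - 3\<close> over all lines spanned by the points from above,
  and counting pairs of points gives the sum of \<open>i + j - (i - j)\<^sup>2\<close> over all these lines.  Combining the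
  two so that monochromatic lines cannot help yields an upper bound \<open>2n - 10\<close> for the sum, over the
  bichromatic lines, of the nonnegative number \<open>i + j + (i - j)\<^sup>2 - 4\<close>, the defect of the line
  (\<open>sum_defect\<close>).  So more than half of the bichromatic lines carry two red and one or two blue points.  Yet the
  sum of \<open>ij\<close> is \<open>nb\<close>, which forces rich lines.  A line with \<open>i, j \<ge> 3\<close> is impossible, since
  the lines joining its red points to the blue points off it, and its blue points to the red points
  off it, would be too many (\<open>no_rich_line\<close>).  For all other lines \<open>ij\<close> is at most the defect
  plus \<open>4\<close>, whence \<open>nb \<le> 2n - 10 + 4(N - 2)\<close> and \<open>n \<le> 8\<close>.

  Parity arguments and direct counts dispose of the remaining values of \<open>n\<close>, with one exception: six red and
  five blue points.  There the five blue points would make two triangles of red points perspective in five of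
  the six possible ways.  By Ceva's theorem the sixth way comes for free, and all six together force a
  number \<open>t \<noteq> 1\<close> with \<open>t\<^sup>3 = 1\<close>; this exists over the complex numbers but not over the reals
  (\<open>no_six_five_configuration\<close>).

  Melchior's inequality itself (\<open>melchior\<close>) is proved without Euler's formula.  Rotating a line about
  one of two neighbouring points of a spanned line until it meets a further point leads to an endpoint of
  another spanned line.  This gives an injection from the neighbouring pairs on spanned lines to the endpoints of
  spanned lines, and it misses the edges of the convex hull.
\<close>

section \<open>Lines in the plane and pairs of points\<close>

text \<open>
  The determinant of the matrix with columns \<open>u\<close> and \<open>v\<close>; it is positive iff \<open>v\<close> points to the left of \<open>u\<close>.
\<close>

definition det2 :: "real^2 \<Rightarrow> real^2 \<Rightarrow> real" where
  "det2 u v = u$1 * v$2 - u$2 * v$1"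

lemma vec2_eq_iff: "(x::real^2) = y \<longleftrightarrow> x$1 = y$1 \<and> x$2 = y$2"
  by (simp add: vec_eq_iff forall_2)

lemma inner_vec2: "(x::real^2) \<bullet> y = x$1 * y$1 + x$2 * y$2"
  by (simp add: inner_vec_def sum_2)

lemma is_line_hull: "p \<noteq> q \<Longrightarrow> is_line (affine hull {p, q})"
  by (simp add: is_line_def aff_dim_2)

lemma line_eq_hull:
  assumes "is_line L" "p \<in> L" "q \<in> L" "p \<noteq> q"
  shows "L = affine hull {p, q}"
proof -
  have "affine hull {p, q} \<subseteq> L"
    using assms by (intro hull_minimal) (auto simp: is_line_def)
  moreover have "affine hull {p, q} \<noteq> {}" by simp
  ultimately show ?thesis
    using affine_dim_equal[of "affine hull {p, q}" L] assms
    by (auto simp: is_line_def aff_dim_2)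
qed

lemma line_unique:
  assumes "is_line L" "is_line M" "p \<in> L" "q \<in> L" "p \<in> M" "q \<in> M" "p \<noteq> q"
  shows "L = M"
  using line_eq_hull assms by metis

lemma mem_hull_det2:
  assumes "p \<noteq> q"
  shows "r \<in> affine hull {p, q} \<longleftrightarrow> det2 (q - p) (r - p) = 0"
proof
  assume "r \<in> affine hull {p, q}"
  then obtain t where "r = p + t *\<^sub>R (q - p)"
    unfolding affine_hull_2_alt by auto
  then show "det2 (q - p) (r - p) = 0" by (simp add: det2_def)
next
  assume *: "det2 (q - p) (r - p) = 0"
  define d where "d = q - p"
  define w where "w = r - p"
  have d: "d \<noteq> 0" using assms by (simp add: d_def)
  then have d2: "d \<bullet> d > 0" by simp
  have "w = ((d \<bullet> w) / (d \<bullet> d)) *\<^sub>R d"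
  proof -
    have "(d \<bullet> d) * w$1 = (d \<bullet> w) * d$1" "(d \<bullet> d) * w$2 = (d \<bullet> w) * d$2"
      using * unfolding d_def[symmetric] w_def[symmetric] det2_def inner_vec2 by algebra+
    then show ?thesis using d2 by (simp add: vec2_eq_iff field_simps)
  qed
  then have "r = p + ((d \<bullet> w) / (d \<bullet> d)) *\<^sub>R (q - p)"
    unfolding w_def d_def by (simp add: algebra_simps)
  then show "r \<in> affine hull {p, q}"
    unfolding affine_hull_2_alt by blast
qed

lemma mem_line_det2:
  assumes "is_line L" "p \<in> L" "q \<in> L" "p \<noteq> q"
  shows "r \<in> L \<longleftrightarrow> det2 (q - p) (r - p) = 0"
  using line_eq_hull[OF assms] mem_hull_det2[OF assms(4)] by simp

definition joins :: "(real^2) set \<Rightarrow> (real^2) set \<Rightarrow> (real^2) set set" where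
  "joins X Y = {L. is_line L \<and> X \<inter> L \<noteq> {} \<and> Y \<inter> L \<noteq> {}}"

lemma joins_commute: "joins X Y = joins Y X"
  by (auto simp: joins_def)

lemma joins_mono: "X \<subseteq> X' \<Longrightarrow> Y \<subseteq> Y' \<Longrightarrow> joins X Y \<subseteq> joins X' Y'"
  by (auto simp: joins_def)

lemma joinsI: "is_line L \<Longrightarrow> x \<in> X \<Longrightarrow> x \<in> L \<Longrightarrow> y \<in> Y \<Longrightarrow> y \<in> L \<Longrightarrow> L \<in> joins X Y"
  by (auto simp: joins_def)

lemma joins_eq_hulls:
  assumes "X \<inter> Y = {}"
  shows "joins X Y = (\<lambda>(x, y). affine hull {x, y}) ` (X \<times> Y)"
proof
  show "joins X Y \<subseteq> (\<lambda>(x, y). affine hull {x, y}) ` (X \<times> Y)"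
  proof
    fix L assume "L \<in> joins X Y"
    then obtain x y where "is_line L" "x \<in> X" "x \<in> L" "y \<in> Y" "y \<in> L"
      by (auto simp: joins_def)
    moreover from this assms have "x \<noteq> y" by auto
    ultimately show "L \<in> (\<lambda>(x, y). affine hull {x, y}) ` (X \<times> Y)"
      using line_eq_hull[of L x y] by force
  qed
next
  show "(\<lambda>(x, y). affine hull {x, y}) ` (X \<times> Y) \<subseteq> joins X Y"
  proof clarsimp
    fix x y assume xy: "x \<in> X" "y \<in> Y"
    then have "x \<noteq> y" using assms by auto
    then show "affine hull {x, y} \<in> joins X Y"
      using xy by (intro joinsI[of _ x _ y] is_line_hull) (auto intro: hull_inc)
  qed
qed

lemma finite_joins:
  assumes "finite X" "finite Y" "X \<inter> Y = {}"
  shows "finite (joins X Y)"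
  using assms by (simp add: joins_eq_hulls)

text \<open>
  Every pair of a point of \<open>X\<close> and a point of \<open>Y\<close> lies on exactly one line.
\<close>

lemma sum_joins:
  assumes "finite X" "finite Y" "X \<inter> Y = {}"
  shows "(\<Sum>L\<in>joins X Y. card (L \<inter> X) * card (L \<inter> Y)) = card X * card Y"
proof -
  have "X \<times> Y = (\<Union>L\<in>joins X Y. (L \<inter> X) \<times> (L \<inter> Y))"
  proof (intro equalityI subsetI)
    fix z assume "z \<in> X \<times> Y"
    then obtain x y where z: "z = (x, y)" "x \<in> X" "y \<in> Y" by auto
    with assms have "x \<noteq> y" by auto
    have "affine hull {x, y} \<in> joins X Y"
      using z \<open>x \<noteq> y\<close> by (intro joinsI[of _ x _ y] is_line_hull) (auto intro: hull_inc)
    moreover have "z \<in> (affine hull {x, y} \<inter> X) \<times> (affine hull {x, y} \<inter> Y)"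
      using z by (auto intro: hull_inc)
    ultimately show "z \<in> (\<Union>L\<in>joins X Y. (L \<inter> X) \<times> (L \<inter> Y))" by blast
  qed auto
  then have "card X * card Y = card (\<Union>L\<in>joins X Y. (L \<inter> X) \<times> (L \<inter> Y))"
    by (metis card_cartesian_product)
  also have "\<dots> = (\<Sum>L\<in>joins X Y. card ((L \<inter> X) \<times> (L \<inter> Y)))"
  proof (intro card_UN_disjoint finite_joins ballI impI)
    fix L M assume LM: "L \<in> joins X Y" "M \<in> joins X Y" "L \<noteq> M"
    show "(L \<inter> X) \<times> (L \<inter> Y) \<inter> (M \<inter> X) \<times> (M \<inter> Y) = {}"
    proof (rule ccontr)
      assume "(L \<inter> X) \<times> (L \<inter> Y) \<inter> (M \<inter> X) \<times> (M \<inter> Y) \<noteq> {}"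
      then obtain x y where "x \<in> L" "x \<in> M" "y \<in> L" "y \<in> M" "x \<in> X" "y \<in> Y" by auto
      then show False using LM assms line_unique[of L M x y] by (auto simp: joins_def)
    qed
  qed (use assms in auto)
  finally show ?thesis by (simp add: card_cartesian_product)
qed

definition spanned :: "(real^2) set \<Rightarrow> (real^2) set set" where
  "spanned P = {L. is_line L \<and> (\<exists>p\<in>P \<inter> L. \<exists>q\<in>P \<inter> L. p \<noteq> q)}"

lemma spannedI: "is_line L \<Longrightarrow> p \<in> P \<Longrightarrow> p \<in> L \<Longrightarrow> q \<in> P \<Longrightarrow> q \<in> L \<Longrightarrow> p \<noteq> q \<Longrightarrow> L \<in> spanned P"
  by (auto simp: spanned_def)

lemma finite_spanned: "finite P \<Longrightarrow> finite (spanned P)"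
proof -
  assume P: "finite P"
  have "spanned P \<subseteq> (\<lambda>(x, y). affine hull {x, y}) ` (P \<times> P)"
    using line_eq_hull by (fastforce simp: spanned_def)
  then show ?thesis using P finite_subset by blast
qed

lemma spanned_card2:
  assumes "finite P" "L \<in> spanned P"
  shows "card (L \<inter> P) \<ge> 2"
proof -
  obtain p q where "p \<in> L \<inter> P" "q \<in> L \<inter> P" "p \<noteq> q"
    using assms by (auto simp: spanned_def)
  then have "card {p, q} \<le> card (L \<inter> P)" using assms by (intro card_mono) auto
  then show ?thesis using \<open>p \<noteq> q\<close> by simp
qed

lemma card_off_diagonal:
  assumes "finite S"
  shows "card {(p, q). p \<in> S \<and> q \<in> S \<and> p \<noteq> q} = card S * (card S - 1)"
proof -
  have "{(p, q). p \<in> S \<and> q \<in> S \<and> p \<noteq> q} = (SIGMA p:S. S - {p})" by auto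
  then show ?thesis using assms by simp
qed

lemma sum_spanned:
  assumes "finite P"
  shows "(\<Sum>L\<in>spanned P. card (L \<inter> P) * (card (L \<inter> P) - 1)) = card P * (card P - 1)"
proof -
  let ?D = "\<lambda>S::(real^2) set. {(p, q). p \<in> S \<and> q \<in> S \<and> p \<noteq> q}"
  have fin: "finite (?D S)" if "finite S" for S
    by (rule finite_subset[of _ "S \<times> S"]) (use that in auto)
  have "?D P = (\<Union>L\<in>spanned P. ?D (L \<inter> P))"
  proof (intro equalityI subsetI)
    fix z assume "z \<in> ?D P"
    then obtain x y where z: "z = (x, y)" "x \<in> P" "y \<in> P" "x \<noteq> y" by auto
    have "affine hull {x, y} \<in> spanned P"
      using z by (intro spannedI[of _ x _ y] is_line_hull) (auto intro: hull_inc)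
    moreover have "z \<in> ?D (affine hull {x, y} \<inter> P)"
      using z by (auto intro: hull_inc)
    ultimately show "z \<in> (\<Union>L\<in>spanned P. ?D (L \<inter> P))" by blast
  qed auto
  then have "card P * (card P - 1) = card (\<Union>L\<in>spanned P. ?D (L \<inter> P))"
    using card_off_diagonal[OF assms] by metis
  also have "\<dots> = (\<Sum>L\<in>spanned P. card (?D (L \<inter> P)))"
  proof (intro card_UN_disjoint finite_spanned ballI impI)
    fix L M assume LM: "L \<in> spanned P" "M \<in> spanned P" "L \<noteq> M"
    show "?D (L \<inter> P) \<inter> ?D (M \<inter> P) = {}"
      using LM line_unique[of L M] by (auto simp: spanned_def)
  next
    fix L show "finite (?D (L \<inter> P))" by (rule fin) (use assms in auto)
  qed (use assms in auto)
  also have "\<dots> = (\<Sum>L\<in>spanned P. card (L \<inter> P) * (card (L \<inter> P) - 1))"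
    by (intro sum.cong refl card_off_diagonal) (use assms in auto)
  finally show ?thesis by (rule sym)
qed

section \<open>Rotating a line about one of two adjacent points\<close>

text \<open>
  The numbers \<open>d \<bullet> u\<close> and \<open>det2 d u\<close> are the coordinates of \<open>u\<close> in the orthogonal frame consisting of
  \<open>d\<close> and its quarter turn, up to the common factor \<open>d \<bullet> d\<close>.  All rotation arguments below are
  computed in such a frame.
\<close>

lemma frame_identities:
  fixes d u v :: "real^2"
  shows "(d \<bullet> d) * det2 u v = (d \<bullet> u) * det2 d v - det2 d u * (d \<bullet> v)"
    and "(d \<bullet> d) * (u \<bullet> v) = (d \<bullet> u) * (d \<bullet> v) + det2 d u * det2 d v"
  unfolding det2_def inner_vec2 by algebra+

lemma frame_zero:
  fixes d u :: "real^2"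
  assumes "d \<noteq> 0" "d \<bullet> u = 0" "det2 d u = 0"
  shows "u = 0"
  using frame_identities(2)[of d u u] assms by simp

text \<open>
  The line directed from \<open>w\<close> to \<open>z\<close> has \<open>z\<close> as its last point of \<open>P\<close>, and \<open>z'\<close> is the point of \<open>P\<close> to its
  left that is nearest to it; among several nearest points it is the first one in the direction of the
  line.  So \<open>z\<close> and \<open>z'\<close> are determined by the directed line.
\<close>

definition touches :: "(real^2) set \<Rightarrow> real^2 \<Rightarrow> real^2 \<Rightarrow> real^2 \<Rightarrow> bool" where
  "touches P w z z' \<longleftrightarrow> w \<in> P \<and> z \<in> P \<and> z' \<in> P \<and> w \<noteq> z \<and>
     (\<forall>r\<in>P. det2 (z - w) (r - z) = 0 \<longrightarrow> (z - w) \<bullet> (r - z) \<le> 0) \<and>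
     det2 (z - w) (z' - z) > 0 \<and>
     (\<forall>r\<in>P. det2 (z - w) (r - z) > 0 \<longrightarrow>
        det2 (z - w) (r - z) > det2 (z - w) (z' - z) \<or>
        det2 (z - w) (r - z) = det2 (z - w) (z' - z) \<and> (z - w) \<bullet> (r - z') \<ge> 0)"

text \<open>
  Let \<open>h r\<close> be \<open>M\<close> times the second coordinate of \<open>r\<close> minus the first one, in the frame of \<open>d = q - p\<close>
  with origin \<open>p\<close>.  It vanishes on the line through \<open>p\<close> and \<open>w\<close>, and \<open>h q = - (d \<bullet> d)\<close>.  The hypotheses
  say that no point of \<open>P\<close> lies in the open strip \<open>- (d \<bullet> d) < h < 0\<close> between the parallels
  through \<open>p\<close> and \<open>q\<close>, so that \<open>q\<close> is nearest to the line, and that the points on the boundary of the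
  strip lie on the right sides of \<open>p\<close> and \<open>q\<close>.
\<close>

lemma touches_core:
  assumes "p \<in> P" "q \<in> P" "p \<noteq> q" "w \<in> P" and d: "d = q - p"
    and up: "\<And>r. r \<in> P \<Longrightarrow> det2 d (r - p) > 0 \<Longrightarrow> d \<bullet> (r - p) \<le> M * det2 d (r - p)"
    and down: "\<And>r. r \<in> P \<Longrightarrow> det2 d (r - p) < 0 \<Longrightarrow> M * det2 d (r - p) \<le> d \<bullet> (r - p) - d \<bullet> d"
    and axis: "\<And>r. r \<in> P \<Longrightarrow> det2 d (r - p) = 0 \<Longrightarrow> d \<bullet> (r - p) \<le> 0 \<or> d \<bullet> d \<le> d \<bullet> (r - p)"
    and w: "det2 d (w - p) > 0" "d \<bullet> (w - p) = M * det2 d (w - p)"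
  shows "touches P w p q"
proof -
  define k where "k = d \<bullet> d"
  define c where "c = (\<lambda>r. det2 d (r - p))"
  define e where "e = (\<lambda>r. d \<bullet> (r - p))"
  have k: "k > 0" using assms(3) by (simp add: k_def d)
  have c0: "c w > 0" using w by (simp add: c_def)
  have Dc: "det2 d (p - w) = - c w" by (simp add: c_def det2_def algebra_simps)
  have De: "d \<bullet> (p - w) = - (M * c w)"
    using w(2) by (simp add: c_def inner_diff_right)
  have det: "k * det2 (p - w) (r - p) = c w * (e r - M * c r)" for r
    unfolding k_def frame_identities(1) Dc De by (simp add: c_def e_def algebra_simps)
  have dot: "k * ((p - w) \<bullet> (r - p)) = - (c w * (M * e r + c r))" for r
    unfolding k_def frame_identities(2) Dc De by (simp add: c_def e_def algebra_simps)
  have q: "c q = 0" "e q = k" by (simp_all add: c_def e_def d k_def det2_def)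
  have detq: "det2 (p - w) (q - p) = c w" using det[of q] q k by simp
  have up': "r \<in> P \<Longrightarrow> c r > 0 \<Longrightarrow> e r - M * c r \<le> 0" for r
    using up[of r] by (simp add: c_def e_def)
  have down': "r \<in> P \<Longrightarrow> c r < 0 \<Longrightarrow> k \<le> e r - M * c r" for r
    using down[of r] by (simp add: c_def e_def k_def)
  have axis': "r \<in> P \<Longrightarrow> c r = 0 \<Longrightarrow> e r \<le> 0 \<or> k \<le> e r" for r
    using axis[of r] by (simp add: c_def e_def k_def)
  have M1: "M * M + 1 > 0" using zero_le_square[of M] by linarith
  have last: "(p - w) \<bullet> (r - p) \<le> 0" if "r \<in> P" "det2 (p - w) (r - p) = 0" for r
  proof -
    have h: "e r = M * c r" using det[of r] that c0 by simp
    have "c r \<ge> 0" using down'[OF that(1)] h k by fastforce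
    then have "(M * M + 1) * c r \<ge> 0" using M1 by (intro mult_nonneg_nonneg) auto
    then have "M * e r + c r \<ge> 0" using h by (simp add: algebra_simps)
    then have "k * ((p - w) \<bullet> (r - p)) \<le> 0"
      unfolding dot using c0 by simp
    then show ?thesis using k by (simp add: mult_le_0_iff)
  qed
  have near: "det2 (p - w) (r - p) > c w \<or> det2 (p - w) (r - p) = c w \<and> (p - w) \<bullet> (r - q) \<ge> 0"
    if "r \<in> P" "det2 (p - w) (r - p) > 0" for r
  proof -
    have "0 < k * det2 (p - w) (r - p)" using that(2) k by simp
    then have h: "e r - M * c r > 0" unfolding det using c0 by (simp add: zero_less_mult_iff)
    have cr: "c r \<le> 0" using up'[OF that(1)] h by force
    have ge: "e r - M * c r \<ge> k"
      using down'[OF that(1)] axis'[OF that(1)] h cr by (cases "c r = 0") auto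
    show ?thesis
    proof (cases "e r - M * c r = k")
      case False
      with ge have "c w * k < c w * (e r - M * c r)" using c0 by simp
      then have "k * c w < k * det2 (p - w) (r - p)" unfolding det by (simp add: mult.commute)
      then show ?thesis using k by simp
    next
      case True
      have "k * det2 (p - w) (r - p) = k * c w" unfolding det True by simp
      then have 1: "det2 (p - w) (r - p) = c w" using k by simp
      have "k * ((p - w) \<bullet> (r - q)) = k * ((p - w) \<bullet> (r - p)) - k * ((p - w) \<bullet> (q - p))"
        by (simp add: inner_diff_right algebra_simps)
      also have "\<dots> = - (c w * (M * e r + c r)) + c w * (M * k)"
        unfolding dot by (simp add: q)
      also have "\<dots> = - (c w * ((M * M + 1) * c r))"
      proof -
        have "e r = k + M * c r" using True by simp
        then show ?thesis by (simp add: algebra_simps)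
      qed
      also have "\<dots> \<ge> 0" using c0 M1 cr by (simp add: mult_le_0_iff)
      finally have "(p - w) \<bullet> (r - q) \<ge> 0" using k by (simp add: zero_le_mult_iff)
      with 1 show ?thesis by simp
    qed
  qed
  have "w \<noteq> p" using c0 by (auto simp: c_def det2_def)
  then show ?thesis
    unfolding touches_def detq using assms(1-4) last near c0 by blast
qed

text \<open>
  No point of \<open>P\<close> lies strictly between \<open>p\<close> and \<open>q\<close>: for collinear points, \<open>r\<close> is strictly between
  them iff the inner product is negative.
\<close>

definition adjacent :: "(real^2) set \<Rightarrow> real^2 \<Rightarrow> real^2 \<Rightarrow> bool" where
  "adjacent P p q \<longleftrightarrow> p \<in> P \<and> q \<in> P \<and> p \<noteq> q \<and>
     (\<forall>r\<in>P. det2 (q - p) (r - p) = 0 \<longrightarrow> (p - r) \<bullet> (q - r) \<ge> 0)"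

lemma adjacent_axis:
  assumes "adjacent P p q" "r \<in> P" "det2 (q - p) (r - p) = 0"
  shows "(q - p) \<bullet> (r - p) \<le> 0 \<or> (q - p) \<bullet> (q - p) \<le> (q - p) \<bullet> (r - p)"
proof -
  define d where "d = q - p"
  define k where "k = d \<bullet> d"
  define e where "e = d \<bullet> (r - p)"
  have k: "k > 0" using assms(1) by (auto simp: adjacent_def k_def d_def)
  have "(p - r) \<bullet> (q - r) = (r - p) \<bullet> (r - p) - e"
    unfolding e_def d_def inner_vec2 by (simp add: algebra_simps)
  then have "k * ((p - r) \<bullet> (q - r)) = k * ((r - p) \<bullet> (r - p)) - k * e"
    by (simp only: right_diff_distrib)
  also have "\<dots> = e * e - k * e"
    unfolding k_def frame_identities(2) using assms(3) by (simp add: e_def d_def)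
  finally have "e * (e - k) = k * ((p - r) \<bullet> (q - r))" by (simp add: right_diff_distrib)
  moreover have "(p - r) \<bullet> (q - r) \<ge> 0" using assms by (simp add: adjacent_def)
  ultimately have "e * (e - k) \<ge> 0" using k by simp
  then show ?thesis
    using k unfolding zero_le_mult_iff by (auto simp: e_def d_def k_def)
qed

lemma adjacent_commute:
  assumes "adjacent P p q" shows "adjacent P q p"
proof -
  have "det2 (p - q) (r - q) = - det2 (q - p) (r - p)" for r
    by (simp add: det2_def algebra_simps)
  then show ?thesis using assms by (auto simp: adjacent_def inner_commute)
qed

text \<open>
  Rotate the direction \<open>q - p\<close> anticlockwise until one of the parallel lines through \<open>p\<close> and \<open>q\<close> meets
  a further point \<open>w\<close> of \<open>P\<close>.  Up to that moment no point can enter the strip between the two lines.  If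
  the line through \<open>p\<close> is hit then \<open>z = p\<close>, otherwise \<open>z = q\<close>; exchanging \<open>p\<close> and \<open>q\<close> turns the second
  case into the first.
\<close>

lemma adjacent_touched:
  assumes "finite P" "\<not> collinear P" and adj: "adjacent P p q"
  shows "\<exists>w z z'. touches P w z z' \<and> {z, z'} = {p, q}"
proof -
  define d where "d = q - p"
  define c where "c = (\<lambda>r. det2 d (r - p))"
  define e where "e = (\<lambda>r. d \<bullet> (r - p))"
  define k where "k = d \<bullet> d"
  have pq: "p \<in> P" "q \<in> P" "p \<noteq> q" using adj by (auto simp: adjacent_def)
  \<comment> \<open>the cotangents of the angles by which the line through \<open>p\<close>, or that
    through \<open>q\<close>, must turn to meet a further point; the largest one belongs to the
    smallest angle\<close>
  define K where "K = (\<lambda>r. e r / c r) ` {r \<in> P. c r > 0} \<union> (\<lambda>r. (e r - k) / c r) ` {r \<in> P. c r < 0}"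
  define M where "M = Max K"
  have finK: "finite K" using assms(1) by (simp add: K_def)
  have "K \<noteq> {}"
  proof
    assume "K = {}"
    then have "\<forall>r\<in>P. c r = 0" by (force simp: K_def)
    then have "P \<subseteq> affine hull {p, q}"
      using mem_hull_det2[OF pq(3)] by (auto simp: c_def d_def)
    then show False using assms(2) collinear_affine_hull by blast
  qed
  then have "M \<in> K" using finK by (simp add: M_def)
  have le: "x \<le> M" if "x \<in> K" for x using finK that by (simp add: M_def)
  have up: "e r \<le> M * c r" if "r \<in> P" "c r > 0" for r
    using le[of "e r / c r"] that by (auto simp: K_def divide_le_eq)
  have down: "M * c r \<le> e r - k" if "r \<in> P" "c r < 0" for r
    using le[of "(e r - k) / c r"] that by (auto simp: K_def divide_le_eq)
  from \<open>M \<in> K\<close> consider (pos) w where "w \<in> P" "c w > 0" "M = e w / c w"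
    | (neg) w where "w \<in> P" "c w < 0" "M = (e w - k) / c w"
    by (auto simp: K_def)
  then show ?thesis
  proof cases
    case pos
    have "touches P w p q"
    proof (rule touches_core[OF pq pos(1) d_def, of M])
      show "d \<bullet> (w - p) = M * det2 d (w - p)"
        using pos by (simp add: c_def e_def)
    qed (use up down pos adjacent_axis[OF adj] in \<open>auto simp: c_def e_def k_def d_def\<close>)
    then show ?thesis by blast
  next
    case neg
    define d' where "d' = p - q"
    have c': "det2 d' (r - q) = - c r" for r
      by (simp add: c_def d_def d'_def det2_def algebra_simps)
    have e': "d' \<bullet> (r - q) = k - e r" for r
      by (simp add: e_def d_def d'_def k_def inner_vec2 algebra_simps)
    have k': "d' \<bullet> d' = k" by (simp add: k_def d_def d'_def inner_vec2 algebra_simps)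
    have "touches P w q p"
    proof (rule touches_core[OF pq(2) pq(1) pq(3)[symmetric] neg(1) d'_def, of M])
      show "d' \<bullet> (w - q) = M * det2 d' (w - q)"
        unfolding c' e' using neg by (simp add: field_simps)
    next
      fix r assume "r \<in> P" "det2 d' (r - q) = 0"
      then show "d' \<bullet> (r - q) \<le> 0 \<or> d' \<bullet> d' \<le> d' \<bullet> (r - q)"
        using adjacent_axis[OF adjacent_commute[OF adj], of r] by (simp add: d'_def)
    next
      fix r assume "r \<in> P" "0 < det2 d' (r - q)"
      then show "d' \<bullet> (r - q) \<le> M * det2 d' (r - q)"
        unfolding c' e' using down[of r] by simp
    next
      fix r assume "r \<in> P" "det2 d' (r - q) < 0"
      then show "M * det2 d' (r - q) \<le> d' \<bullet> (r - q) - d' \<bullet> d'"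
        unfolding c' e' k' using up[of r] by simp
    qed (use neg c' in auto)
    then show ?thesis by blast
  qed
qed

lemma same_direction:
  assumes "is_line L" "z \<in> L" "w \<in> L" "w' \<in> L" "w \<noteq> z" "w' \<noteq> z"
    and "(z - w) \<bullet> (w' - z) \<le> 0"
  obtains c where "c > 0" "z - w' = c *\<^sub>R (z - w)"
proof -
  have "w' \<in> affine hull {z, w}" using line_eq_hull[OF assms(1-3)] assms by auto
  then obtain t where t: "w' = z + t *\<^sub>R (w - z)"
    unfolding affine_hull_2_alt by auto
  then have 1: "z - w' = t *\<^sub>R (z - w)" by (simp add: algebra_simps)
  have "(z - w) \<bullet> (w' - z) = - t * ((z - w) \<bullet> (z - w))"
    unfolding t by (simp add: inner_vec2 algebra_simps)
  moreover have "(z - w) \<bullet> (z - w) > 0" using assms by simp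
  ultimately have "t \<ge> 0" using assms(7) mult_neg_pos[of t "(z - w) \<bullet> (z - w)"] by fastforce
  moreover have "t \<noteq> 0" using t assms by auto
  ultimately show ?thesis using that[of t] 1 by simp
qed

lemma det2_scaleR [simp]: "det2 (c *\<^sub>R u) v = c * det2 u v"
  by (simp add: det2_def algebra_simps)

text \<open>
  The two directions from \<open>w\<close> and from \<open>w'\<close> to \<open>z\<close> agree, as \<open>z\<close> is last in both; so \<open>a\<close> and \<open>b\<close>
  are the nearest point to the left of the same directed line.
\<close>

lemma touches_determined:
  assumes "touches P w z a" "touches P w' z b" "is_line L" "z \<in> L" "w \<in> L" "w' \<in> L"
  shows "a = b"
proof -
  define D where "D = z - w"
  have "(z - w) \<bullet> (w' - z) \<le> 0"
  proof -
    have "det2 (z - w) (w' - z) = 0"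
      using mem_line_det2[OF assms(3,5,4), of w'] assms by (auto simp: touches_def det2_def algebra_simps)
    then show ?thesis using assms by (auto simp: touches_def)
  qed
  then obtain c where c: "c > 0" "z - w' = c *\<^sub>R D"
    using same_direction[OF assms(3-6)] assms(1,2) by (auto simp: touches_def D_def)
  have a: "det2 D (a - z) > 0" "\<And>r. r \<in> P \<Longrightarrow> det2 D (r - z) > 0 \<Longrightarrow> 
        det2 D (r - z) > det2 D (a - z) \<or> det2 D (r - z) = det2 D (a - z) \<and> D \<bullet> (r - a) \<ge> 0"
    and aP: "a \<in> P" and "D \<noteq> 0"
    using assms(1) by (auto simp: touches_def D_def)
  have b: "det2 D (b - z) > 0" "\<And>r. r \<in> P \<Longrightarrow> det2 D (r - z) > 0 \<Longrightarrow> 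
        det2 D (r - z) > det2 D (b - z) \<or> det2 D (r - z) = det2 D (b - z) \<and> D \<bullet> (r - b) \<ge> 0"
    and bP: "b \<in> P"
    using assms(2) c(1) unfolding touches_def c(2) by (auto simp: zero_less_mult_iff zero_le_mult_iff)
  have "det2 D (a - z) = det2 D (b - z)" "D \<bullet> (b - a) \<ge> 0" "D \<bullet> (a - b) \<ge> 0"
    using a(2)[OF bP b(1)] b(2)[OF aP a(1)] by auto
  moreover have "det2 D (a - b) = det2 D (a - z) - det2 D (b - z)"
    by (simp add: det2_def algebra_simps)
  ultimately have "det2 D (a - b) = 0" "D \<bullet> (a - b) = 0"
    by (auto simp: inner_diff_right)
  then show ?thesis using frame_zero[OF \<open>D \<noteq> 0\<close>, of "a - b"] by simp
qed

section \<open>Endpoints, neighbours and hull edges\<close>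

text \<open>
  An endpoint has all points of \<open>P \<inter> L\<close> on one side, that is, no two of them in opposite directions.
\<close>

definition endpoints :: "(real^2) set \<Rightarrow> (real^2) set \<Rightarrow> (real^2) set" where
  "endpoints P L = {z \<in> P \<inter> L. \<forall>u\<in>P \<inter> L. \<forall>v\<in>P \<inter> L. (u - z) \<bullet> (v - z) \<ge> 0}"

definition neighbours :: "(real^2) set \<Rightarrow> (real^2) set \<Rightarrow> (real^2) set set" where
  "neighbours P L = {{p, q} | p q. p \<in> L \<and> q \<in> L \<and> adjacent P p q}"

text \<open>
  A real coordinate on a line; it reduces statements on betweenness to signs of products of differences.
\<close>

lemma line_coordinate:
  assumes "is_line L"
  obtains g :: "real^2 \<Rightarrow> real" and K where "K > 0" "inj_on g L"
    "\<And>x y z. x \<in> L \<Longrightarrow> y \<in> L \<Longrightarrow> z \<in> L \<Longrightarrow> (x - z) \<bullet> (y - z) = K * ((g x - g z) * (g y - g z))"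
proof -
  obtain a b where ab: "a \<noteq> b" "L = affine hull {a, b}"
  proof -
    have "aff_dim L = 1" "affine L" using assms by (auto simp: is_line_def)
    then have "L \<noteq> {}" by auto
    then obtain a where a: "a \<in> L" by blast
    have "L \<noteq> {a}" using \<open>aff_dim L = 1\<close> by auto
    then obtain b where "b \<in> L" "b \<noteq> a" using a by blast
    then show ?thesis using line_eq_hull[OF assms a, of b] that[of a b] by simp
  qed
  define d where "d = b - a"
  have k: "d \<bullet> d > 0" using ab by (simp add: d_def)
  have par: "\<exists>t. x = a + t *\<^sub>R d" if "x \<in> L" for x
    using that unfolding ab(2) affine_hull_2_alt d_def by auto
  define g where "g = (\<lambda>x. d \<bullet> (x - a) / (d \<bullet> d))"
  have g: "g (a + t *\<^sub>R d) = t" for t using k by (simp add: g_def)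
  show ?thesis
  proof (rule that[of "d \<bullet> d" g])
    show "inj_on g L" by (rule inj_onI) (metis par g)
  next
    fix x y z assume "x \<in> L" "y \<in> L" "z \<in> L"
    then obtain s t u where "x = a + s *\<^sub>R d" "y = a + t *\<^sub>R d" "z = a + u *\<^sub>R d"
      using par by metis
    moreover from this have "x - z = (s - u) *\<^sub>R d" "y - z = (t - u) *\<^sub>R d"
      by (simp_all add: algebra_simps)
    ultimately show "(x - z) \<bullet> (y - z) = d \<bullet> d * ((g x - g z) * (g y - g z))"
      by (simp add: g)
  qed (use k in auto)
qed

lemma card_endpoints:
  assumes "is_line L"
  shows "card (endpoints P L) \<le> 2"
proof (rule ccontr)
  assume "\<not> card (endpoints P L) \<le> 2"
  then obtain T where "T \<subseteq> endpoints P L" "card T = 3"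
    using obtain_subset_with_card_n[of 3 "endpoints P L"] by auto
  then obtain x y z where xyz: "x \<in> endpoints P L" "y \<in> endpoints P L" "z \<in> endpoints P L"
    "x \<noteq> y" "y \<noteq> z" "x \<noteq> z"
    by (auto simp: card_3_iff)
  obtain g K where g: "K > 0" "inj_on g L"
    "\<And>x y z. x \<in> L \<Longrightarrow> y \<in> L \<Longrightarrow> z \<in> L \<Longrightarrow> (x - z) \<bullet> (y - z) = K * ((g x - g z) * (g y - g z))"
    using line_coordinate[OF assms] by metis
  have L: "x \<in> L" "y \<in> L" "z \<in> L" using xyz by (auto simp: endpoints_def)
  have nn: "(g u - g w) * (g v - g w) \<ge> 0"
    if "u \<in> endpoints P L" "v \<in> endpoints P L" "w \<in> endpoints P L" for u v w
  proof -
    have "(u - w) \<bullet> (v - w) \<ge> 0" "u \<in> L" "v \<in> L" "w \<in> L"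
      using that by (simp_all add: endpoints_def)
    then show ?thesis using g(1) g(3)[of u v w] by (simp add: zero_le_mult_iff)
  qed
  have "g x \<noteq> g y" "g y \<noteq> g z" "g x \<noteq> g z" using xyz L g(2) by (auto dest: inj_onD)
  moreover have "(g x - g z) * (g y - g z) \<ge> 0" "(g x - g y) * (g z - g y) \<ge> 0"
    "(g y - g x) * (g z - g x) \<ge> 0" by (intro nn xyz)+
  ultimately have "(g x - g z) * (g y - g z) > 0" "(g x - g y) * (g z - g y) > 0"
    "(g y - g x) * (g z - g x) > 0" by (simp_all add: less_le)
  then show False by (simp only: zero_less_mult_iff) linarith
qed

text \<open>
  Every point of \<open>L \<inter> P\<close> except the last one forms a neighbouring pair with its successor.
\<close>

lemma card_neighbours:
  assumes "finite P" "is_line L" "P \<inter> L \<noteq> {}"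
  shows "card (L \<inter> P) - 1 \<le> card (neighbours P L)"
proof -
  obtain g K where g: "K > 0" "inj_on g L"
    "\<And>x y z. x \<in> L \<Longrightarrow> y \<in> L \<Longrightarrow> z \<in> L \<Longrightarrow> (x - z) \<bullet> (y - z) = K * ((g x - g z) * (g y - g z))"
    using line_coordinate[OF assms(2)] by metis
  define S where "S = L \<inter> P"
  have S: "finite S" "S \<noteq> {}" using assms by (auto simp: S_def)
  have injS: "inj_on g S" using g(2) by (auto simp: S_def inj_on_def)
  have "Max (g ` S) \<in> g ` S" using S by simp
  then obtain m where "m \<in> S" "g m = Max (g ` S)" by auto
  then have m: "m \<in> S" "\<And>x. x \<in> S \<Longrightarrow> g x \<le> g m" using S by auto
  have "\<exists>y\<in>S. g x < g y \<and> (\<forall>r\<in>S. g x < g r \<longrightarrow> g y \<le> g r)" if "x \<in> S - {m}" for x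
  proof -
    let ?U = "{r \<in> S. g x < g r}"
    have "g x < g m" using that m injS by (metis DiffD1 DiffD2 antisym_conv3 inj_onD insertI1 not_less)
    then have U: "finite ?U" "?U \<noteq> {}" using S m by auto
    then have "Min (g ` ?U) \<in> g ` ?U" by simp
    then obtain y where "y \<in> ?U" "g y = Min (g ` ?U)" by auto
    moreover have "g y \<le> g r" if "r \<in> S" "g x < g r" for r
      unfolding \<open>g y = Min (g ` ?U)\<close> using U that by (intro Min_le) auto
    ultimately show ?thesis by blast
  qed
  then obtain nx where nx: "\<And>x. x \<in> S - {m} \<Longrightarrow> nx x \<in> S \<and> g x < g (nx x) \<and> (\<forall>r\<in>S. g x < g r \<longrightarrow> g (nx x) \<le> g r)"
    by metis
  have "inj_on (\<lambda>x. {x, nx x}) (S - {m})"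
  proof (rule inj_onI)
    fix x y assume "x \<in> S - {m}" "y \<in> S - {m}" "{x, nx x} = {y, nx y}"
    then show "x = y" using nx[of x] nx[of y] by (auto simp: doubleton_eq_iff)
  qed
  moreover have "(\<lambda>x. {x, nx x}) ` (S - {m}) \<subseteq> neighbours P L"
  proof
    fix e assume "e \<in> (\<lambda>x. {x, nx x}) ` (S - {m})"
    then obtain x where x: "x \<in> S - {m}" "e = {x, nx x}" by auto
    have ne: "x \<noteq> nx x" and SL: "x \<in> L" "nx x \<in> L" "x \<in> P" "nx x \<in> P"
      using nx[OF x(1)] x by (auto simp: S_def)
    have "(x - r) \<bullet> (nx x - r) \<ge> 0" if "r \<in> P" "det2 (nx x - x) (r - x) = 0" for r
    proof -
      have r: "r \<in> L" using mem_line_det2[OF assms(2) SL(1,2) ne] that by simp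
      then have "r \<in> S" using that by (simp add: S_def)
      then have "(g x - g r) * (g (nx x) - g r) \<ge> 0"
        using nx[OF x(1)] by (cases "g x < g r") (auto simp: zero_le_mult_iff)
      then show ?thesis using g(1) g(3)[OF SL(1,2) r] by simp
    qed
    then have "adjacent P x (nx x)" using ne SL by (auto simp: adjacent_def)
    then show "e \<in> neighbours P L" using x SL by (auto simp: neighbours_def)
  qed
  moreover have "finite (neighbours P L)"
  proof (rule finite_subset)
    show "neighbours P L \<subseteq> Pow P" by (auto simp: neighbours_def adjacent_def)
  qed (use assms in simp)
  ultimately have "card (S - {m}) \<le> card (neighbours P L)"
    by (rule card_inj_on_le)
  moreover have "card (S - {m}) = card (L \<inter> P) - 1" using m S by (simp add: S_def)
  ultimately show ?thesis by simp
qed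

definition hull_edge :: "(real^2) set \<Rightarrow> real^2 \<Rightarrow> real^2 \<Rightarrow> bool" where
  "hull_edge P w z \<longleftrightarrow> w \<in> P \<and> z \<in> P \<and> w \<noteq> z \<and>
     (\<forall>r\<in>P. det2 (z - w) (r - z) \<le> 0) \<and>
     (\<forall>r\<in>P. det2 (z - w) (r - z) = 0 \<longrightarrow> (z - w) \<bullet> (r - z) \<le> 0)"

text \<open>
  Rotate the supporting direction \<open>u\<close> at \<open>b\<close> clockwise until the ray from \<open>b\<close> meets a point of \<open>P\<close>,
  and take the farthest point on that ray.
\<close>

lemma hull_edge_exists:
  assumes "finite P" "b \<in> P" "u \<noteq> 0"
    and side: "\<And>r. r \<in> P \<Longrightarrow> det2 u (r - b) \<le> 0"
    and axis: "\<And>r. r \<in> P \<Longrightarrow> det2 u (r - b) = 0 \<Longrightarrow> u \<bullet> (r - b) \<le> 0"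
    and "r0 \<in> P" "det2 u (r0 - b) < 0"
  obtains z where "hull_edge P b z" "det2 u (z - b) < 0"
proof -
  define k where "k = u \<bullet> u"
  define c where "c = (\<lambda>r. det2 u (r - b))"
  define e where "e = (\<lambda>r. u \<bullet> (r - b))"
  have k: "k > 0" using assms(3) by (simp add: k_def)
  let ?U = "{r \<in> P. c r < 0}"
  have U: "finite ?U" "?U \<noteq> {}" using assms by (auto simp: c_def)
  define M where "M = Max ((\<lambda>r. e r / (- c r)) ` ?U)"
  have "M \<in> (\<lambda>r. e r / (- c r)) ` ?U" unfolding M_def using U by (intro Max_in) auto
  then obtain z0 where z0: "z0 \<in> P" "c z0 < 0" "e z0 = - M * c z0"
    by (auto simp: field_simps)
  have le: "e r \<le> - M * c r" if "r \<in> P" "c r < 0" for r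
  proof -
    have "e r / (- c r) \<le> M" unfolding M_def using U that by (intro Max_ge) auto
    then show ?thesis using that by (simp add: field_simps)
  qed
  \<comment> \<open>the points on the ray met first; the smallest \<open>c\<close> belongs to the
    farthest one\<close>
  let ?V = "{r \<in> P. c r < 0 \<and> e r = - M * c r}"
  have V: "finite ?V" "?V \<noteq> {}" using assms z0 by auto
  then have "Min (c ` ?V) \<in> c ` ?V" by (intro Min_in) auto
  then obtain z where z: "z \<in> P" "c z < 0" "e z = - M * c z" "c z = Min (c ` ?V)" by auto
  have zmin: "c z \<le> c r" if "r \<in> P" "c r < 0" "e r = - M * c r" for r
    unfolding z(4) using V that by (intro Min_le) auto
  have shift: "det2 (z - b) (r - z) = det2 (z - b) (r - b)" for r
    by (simp add: det2_def algebra_simps)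
  have det: "k * det2 (z - b) (r - b) = - c z * (e r + M * c r)" for r
  proof -
    have "k * det2 (z - b) (r - b) = e z * c r - c z * e r"
      unfolding k_def frame_identities(1) by (simp add: c_def e_def)
    then show ?thesis unfolding z(3) by (simp add: right_diff_distrib ring_distribs)
  qed
  have ax: "c r = 0 \<Longrightarrow> e r \<le> 0" "c r \<le> 0" if "r \<in> P" for r
    using axis[OF that] side[OF that] by (auto simp: c_def e_def)
  have nonpos: "e r + M * c r \<le> 0" if "r \<in> P" for r
    using le[OF that] ax[OF that] by (cases "c r = 0") force+
  have "hull_edge P b z"
    unfolding hull_edge_def shift
  proof (intro conjI ballI impI)
    show "b \<noteq> z" using z by (auto simp: c_def det2_def)
  next
    fix r assume r: "r \<in> P"
    have "k * det2 (z - b) (r - b) \<le> 0" unfolding det using nonpos[OF r] z(2)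
      by (simp add: mult_nonneg_nonpos mult_nonpos_nonpos mult_le_0_iff zero_le_mult_iff)
    then show "det2 (z - b) (r - b) \<le> 0" using k by (simp add: mult_le_0_iff)
  next
    fix r assume r: "r \<in> P" and "det2 (z - b) (r - b) = 0"
    then have er: "e r = - M * c r" using det[of r] z(2) by simp
    have cr: "c z \<le> c r"
      using zmin[OF r] er ax[OF r] z(2) by (cases "c r = 0") auto
    have "k * ((z - b) \<bullet> (r - z)) = k * ((z - b) \<bullet> (r - b)) - k * ((z - b) \<bullet> (z - b))"
      by (simp add: inner_diff_right algebra_simps)
    also have "\<dots> = (e z * e r + c z * c r) - (e z * e z + c z * c z)"
      unfolding k_def frame_identities(2) by (simp add: c_def e_def)
    also have "\<dots> = (M * M + 1) * (c z * (c r - c z))"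
      unfolding er z(3) by (simp add: algebra_simps)
    also have "\<dots> \<le> 0"
    proof (rule mult_nonneg_nonpos)
      show "c z * (c r - c z) \<le> 0" using cr z(2) by (intro mult_nonpos_nonneg) auto
    qed simp
    finally show "(z - b) \<bullet> (r - z) \<le> 0" using k by (simp add: mult_le_0_iff)
  qed (use z assms in auto)
  then show ?thesis using that z(2) by (simp add: c_def)
qed

text \<open>
  The convex hull can be traversed from edge to edge, and the direction really turns at every
  vertex.
\<close>

lemma hull_edge_next:
  assumes "finite P" "\<not> collinear P" "hull_edge P a b"
  obtains z where "hull_edge P b z" "det2 (b - a) (z - b) < 0"
proof -
  have ab: "a \<noteq> b" using assms by (simp add: hull_edge_def)
  have "\<exists>r0\<in>P. det2 (b - a) (r0 - b) < 0"
  proof (rule ccontr)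
    assume neg: "\<not> ?thesis"
    have "P \<subseteq> affine hull {a, b}"
    proof
      fix r assume "r \<in> P"
      then have "det2 (b - a) (r - b) = 0"
        using neg assms(3) by (force simp: hull_edge_def)
      then have "det2 (b - a) (r - a) = 0" by (simp add: det2_def algebra_simps)
      then show "r \<in> affine hull {a, b}" using mem_hull_det2[OF ab] by simp
    qed
    then show False using assms(2) collinear_affine_hull by blast
  qed
  then obtain r0 where r0: "r0 \<in> P" "det2 (b - a) (r0 - b) < 0" by blast
  have "b - a \<noteq> 0" "b \<in> P" using ab assms(3) by (auto simp: hull_edge_def)
  moreover have "\<And>r. r \<in> P \<Longrightarrow> det2 (b - a) (r - b) \<le> 0"
    "\<And>r. r \<in> P \<Longrightarrow> det2 (b - a) (r - b) = 0 \<Longrightarrow> (b - a) \<bullet> (r - b) \<le> 0"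
    using assms(3) by (auto simp: hull_edge_def)
  ultimately obtain z where "hull_edge P b z" "det2 (b - a) (z - b) < 0"
    using hull_edge_exists[OF assms(1) _ _ _ _ r0] by metis
  then show ?thesis by (rule that)
qed

text \<open>
  A linear form that is injective on \<open>P\<close> attains its maximum at a single point, which is a vertex of
  the convex hull; this gives a supporting direction to start from.
\<close>

lemma hull_edge_first:
  assumes "finite P" "\<not> collinear P"
  obtains a b where "hull_edge P a b"
proof -
  have "\<exists>t. inj_on (\<lambda>x::real^2. x$1 + t * x$2) P"
  proof -
    \<comment> \<open>each pair of points excludes at most one value of \<open>t\<close>\<close>
    let ?bad = "(\<lambda>(x, y). (x$1 - y$1) / (y$2 - x$2)) ` (P \<times> P)"
    have "finite ?bad" using assms by simp
    then obtain t :: real where t: "t \<notin> ?bad"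
      using ex_new_if_finite infinite_UNIV_char_0 by blast
    have "inj_on (\<lambda>x::real^2. x$1 + t * x$2) P"
    proof (rule inj_onI)
      fix x y assume xy: "x \<in> P" "y \<in> P" "x$1 + t * x$2 = y$1 + t * y$2"
      then have "(x$1 - y$1) / (y$2 - x$2) \<in> ?bad"
        by (intro image_eqI[of _ _ "(x, y)"]) simp_all
      then have "t \<noteq> (x$1 - y$1) / (y$2 - x$2)" using t by metis
      moreover have "t * (y$2 - x$2) = x$1 - y$1" using xy by (simp add: algebra_simps)
      ultimately have "y$2 - x$2 = 0" by (metis eq_divide_imp)
      then have "y$2 = x$2" by simp
      then show "x = y" using xy by (simp add: vec2_eq_iff)
    qed
    then show ?thesis by blast
  qed
  then obtain t where inj: "inj_on (\<lambda>x::real^2. x$1 + t * x$2) P" by blast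
  define \<phi> where "\<phi> = (\<lambda>x::real^2. x$1 + t * x$2)"
  have "P \<noteq> {}" using assms by auto
  then have "Max (\<phi> ` P) \<in> \<phi> ` P" using assms by (intro Max_in) auto
  then obtain b where b: "b \<in> P" "\<phi> b = Max (\<phi> ` P)" by auto
  have le: "\<phi> r \<le> \<phi> b" if "r \<in> P" for r unfolding b(2) using assms that by (intro Max_ge) auto
  have lt: "\<phi> r < \<phi> b" if "r \<in> P" "r \<noteq> b" for r
    using le[OF that(1)] inj that b(1) by (force simp: \<phi>_def inj_on_def)
  \<comment> \<open>chosen such that \<open>det2 u\<close> is the linear form
    \<open>\<phi>\<close>\<close>
  define u :: "real^2" where "u = vector [t, -1]"
  have u: "det2 u (r - b) = \<phi> r - \<phi> b" for r
    by (simp add: u_def det2_def \<phi>_def algebra_simps)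
  have u0: "u \<noteq> 0" by (simp add: u_def vec2_eq_iff)
  have "P \<noteq> {b}" using assms by auto
  then obtain r0 where r0: "r0 \<in> P" "r0 \<noteq> b" using b(1) by blast
  have side: "det2 u (r - b) \<le> 0" if "r \<in> P" for r using le[OF that] u[of r] by simp
  have axis: "u \<bullet> (r - b) \<le> 0" if "r \<in> P" "det2 u (r - b) = 0" for r
    using lt[of r] u[of r] that by (cases "r = b") auto
  have "det2 u (r0 - b) < 0" using lt[OF r0] u[of r0] by simp
  from hull_edge_exists[OF assms(1) b(1) u0 side axis r0(1) this]
  show ?thesis using that by metis
qed

section \<open>Melchior's inequality\<close>

lemma mem_line_det2':
  assumes "is_line L" "w \<in> L" "z \<in> L" "w \<noteq> z"
  shows "r \<in> L \<longleftrightarrow> det2 (z - w) (r - z) = 0"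
  using mem_line_det2[OF assms, of r] by (simp add: det2_def algebra_simps)

lemma last_endpoint:
  assumes "is_line L" "w \<in> P \<inter> L" "z \<in> P \<inter> L" "w \<noteq> z"
    and last: "\<And>r. r \<in> P \<inter> L \<Longrightarrow> (z - w) \<bullet> (r - z) \<le> 0"
  shows "z \<in> endpoints P L"
  unfolding endpoints_def
proof (intro CollectI conjI ballI assms(3))
  fix u v assume uv: "u \<in> P \<inter> L" "v \<in> P \<inter> L"
  define d where "d = z - w"
  have "det2 d (u - z) = 0"
    using mem_line_det2'[of L w z u] assms uv by (simp add: d_def)
  then have "(d \<bullet> d) * ((u - z) \<bullet> (v - z)) = (d \<bullet> (u - z)) * (d \<bullet> (v - z))"
    by (simp add: frame_identities(2))
  also have "\<dots> \<ge> 0" using last[OF uv(1)] last[OF uv(2)] unfolding d_def by (rule mult_nonpos_nonpos)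
  finally have "(d \<bullet> d) * ((u - z) \<bullet> (v - z)) \<ge> 0" .
  moreover have "d \<bullet> d > 0" using assms(4) by (simp add: d_def)
  ultimately show "(u - z) \<bullet> (v - z) \<ge> 0" using zero_le_mult_iff by (metis less_le_not_le)
qed

text \<open>
  Let a flag be a spanned line together with one of its at most two endpoints.  By
  \<open>adjacent_touched\<close> every pair of neighbours on a spanned line is the pair \<open>{z, z'}\<close> of a flag, and
  by \<open>touches_determined\<close> the flag determines the pair.  A flag that is an edge of the convex hull,
  directed such that all points lie to its right, has no point \<open>z'\<close> and is therefore not used; there are at
  least three of these.  Since a line with \<open>k\<close> points has \<open>k - 1\<close> neighbouring pairs, the inequality follows.
\<close>

theorem melchior:
  assumes "finite P" "\<not> collinear P"
  shows "(\<Sum>L\<in>spanned P. card (L \<inter> P) - 1) + 3 \<le> 2 * card (spanned P)"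
proof -
  define Flags where "Flags = (SIGMA L:spanned P. endpoints P L)"
  define C where "C = (\<Union>L\<in>spanned P. neighbours P L)"
  define flag where "flag = (\<lambda>w z::real^2. (affine hull {w, z}, z))"
  note finS = finite_spanned[OF assms(1)]
  have line: "is_line L" "P \<inter> L \<noteq> {}" if "L \<in> spanned P" for L
    using that by (auto simp: spanned_def)
  have finE: "finite (endpoints P L)" for L
    by (rule finite_subset[OF _ assms(1)]) (auto simp: endpoints_def)
  have finN: "finite (neighbours P L)" for L
    by (rule finite_subset[of _ "Pow P"]) (use assms(1) in \<open>auto simp: neighbours_def adjacent_def\<close>)
  have finF: "finite Flags" unfolding Flags_def using finS finE by blast
  have "card Flags = (\<Sum>L\<in>spanned P. card (endpoints P L))"
    unfolding Flags_def by (rule card_SigmaI) (use finS finE in auto)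
  also have "\<dots> \<le> (\<Sum>L\<in>spanned P. 2)"
    by (intro sum_mono card_endpoints line)
  finally have cardF: "card Flags \<le> 2 * card (spanned P)" by simp
  have "(\<Sum>L\<in>spanned P. card (L \<inter> P) - 1) \<le> (\<Sum>L\<in>spanned P. card (neighbours P L))"
    by (intro sum_mono card_neighbours assms(1) line)
  also have "\<dots> = card C"
    unfolding C_def
  proof (rule card_UN_disjoint[symmetric, OF finS])
    show "\<forall>L\<in>spanned P. finite (neighbours P L)" using finN by blast
    show "\<forall>L\<in>spanned P. \<forall>M\<in>spanned P. L \<noteq> M \<longrightarrow> neighbours P L \<inter> neighbours P M = {}"
    proof (intro ballI impI, rule ccontr)
      fix L M assume LM: "L \<in> spanned P" "M \<in> spanned P" "L \<noteq> M" "neighbours P L \<inter> neighbours P M \<noteq> {}"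
      then obtain e where "e \<in> neighbours P L" "e \<in> neighbours P M" by blast
      then obtain p q where "e = {p, q}" "p \<in> L" "q \<in> L" "adjacent P p q"
        by (auto simp: neighbours_def)
      moreover have "e \<subseteq> M" using \<open>e \<in> neighbours P M\<close> by (auto simp: neighbours_def)
      ultimately show False using line_unique[OF line(1)[OF LM(1)] line(1)[OF LM(2)], of p q] LM(3)
        by (auto simp: adjacent_def)
    qed
  qed
  finally have cardC: "(\<Sum>L\<in>spanned P. card (L \<inter> P) - 1) \<le> card C" .
  have "\<forall>e\<in>C. \<exists>w z z'. touches P w z z' \<and> {z, z'} = e"
  proof
    fix e assume "e \<in> C"
    then obtain p q where "adjacent P p q" "e = {p, q}" by (auto simp: C_def neighbours_def)
    then show "\<exists>w z z'. touches P w z z' \<and> {z, z'} = e"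
      using adjacent_touched[OF assms] by simp
  qed
  then obtain w z z' where touch: "\<And>e. e \<in> C \<Longrightarrow> touches P (w e) (z e) (z' e)"
      and e: "\<And>e. e \<in> C \<Longrightarrow> {z e, z' e} = e"
    by metis
  define F where "F = (\<lambda>e. flag (w e) (z e))"
  have hull: "is_line (affine hull {x, y})" "x \<in> affine hull {x, y}" "y \<in> affine hull {x, y}"
    if "x \<noteq> y" for x y :: "real^2"
    using that is_line_hull by (auto intro: hull_inc)
  have flagI: "flag x y \<in> Flags"
    if "x \<in> P" "y \<in> P" "x \<noteq> y"
      "\<And>r. r \<in> P \<Longrightarrow> det2 (y - x) (r - y) = 0 \<Longrightarrow> (y - x) \<bullet> (r - y) \<le> 0" for x y
  proof -
    let ?L = "affine hull {x, y}"
    have "y \<in> endpoints P ?L"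
    proof (rule last_endpoint[of _ x])
      fix r assume "r \<in> P \<inter> ?L"
      then show "(y - x) \<bullet> (r - y) \<le> 0"
        using that(4)[of r] mem_line_det2'[OF hull[OF that(3)] that(3), of r] by auto
    qed (use that hull in auto)
    moreover have "?L \<in> spanned P"
      using hull[OF that(3)] that by (intro spannedI[of _ x _ y]) auto
    ultimately show ?thesis by (simp add: Flags_def flag_def)
  qed
  have Ff: "F ` C \<subseteq> Flags"
  proof (intro image_subsetI)
    fix x assume "x \<in> C"
    from touch[OF this] show "F x \<in> Flags"
      unfolding F_def touches_def by (intro flagI) blast+
  qed
  have "inj_on F C"
  proof (rule inj_onI)
    fix x y assume xy: "x \<in> C" "y \<in> C" "F x = F y"
    note tx = touch[OF xy(1)] and ty = touch[OF xy(2)]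
    have zz: "z y = z x" and LL: "affine hull {w y, z y} = affine hull {w x, z x}"
      using xy(3) unfolding F_def flag_def prod.inject by metis+
    have nx: "w x \<noteq> z x" "w y \<noteq> z y" using tx ty unfolding touches_def by blast+
    have "z' x = z' y"
    proof (rule touches_determined[OF tx ty[unfolded zz]])
      show "is_line (affine hull {w x, z x})" "z x \<in> affine hull {w x, z x}"
        "w x \<in> affine hull {w x, z x}" by (rule hull[OF nx(1)])+
      show "w y \<in> affine hull {w x, z x}" using hull(2)[OF nx(2)] unfolding LL .
    qed
    then show "x = y" using e[OF xy(1)] e[OF xy(2)] zz by metis
  qed
  then have cFC: "card (F ` C) = card C" by (rule card_image)
  obtain h0 h1 where h01: "hull_edge P h0 h1" using hull_edge_first[OF assms] .
  obtain h2 where h12: "hull_edge P h1 h2" and t2: "det2 (h1 - h0) (h2 - h1) < 0"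
    using hull_edge_next[OF assms h01] .
  obtain h3 where h23: "hull_edge P h2 h3" and t3: "det2 (h2 - h1) (h3 - h2) < 0"
    using hull_edge_next[OF assms h12] .
  have ne: "h0 \<noteq> h1" "h1 \<noteq> h2" "h2 \<noteq> h3" using h01 h12 h23 unfolding hull_edge_def by blast+
  define H where "H = {flag h0 h1, flag h1 h2, flag h2 h3}"
  have "affine hull {h2, h3} \<noteq> affine hull {h0, h1} \<or> h3 \<noteq> h1"
  proof (rule ccontr)
    assume *: "\<not> ?thesis"
    then have "h2 \<in> affine hull {h0, h1}" using hull[OF ne(3)] by metis
    then show False using mem_line_det2'[OF hull[OF ne(1)] ne(1), of h2] t2 by simp
  qed
  then have "flag h0 h1 \<noteq> flag h1 h2" "flag h1 h2 \<noteq> flag h2 h3" "flag h0 h1 \<noteq> flag h2 h3"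
    using ne unfolding flag_def prod.inject by metis+
  then have "card H = 3" by (simp add: H_def)
  have "flag x y \<in> Flags" if "hull_edge P x y" for x y
    using that unfolding hull_edge_def by (intro flagI) blast+
  then have Hf: "H \<subseteq> Flags" using h01 h12 h23 by (simp add: H_def)
  have noth: "flag x y \<notin> F ` C" if "hull_edge P x y" for x y
  proof
    assume "flag x y \<in> F ` C"
    then obtain a where a: "a \<in> C" "flag x y = F a" by auto
    note t = touch[OF a(1)]
    have y: "z a = y" and LL: "affine hull {w a, y} = affine hull {x, y}"
      using a(2) unfolding F_def flag_def prod.inject by metis+
    have n: "w a \<noteq> y" "x \<noteq> y" using t that unfolding y touches_def hull_edge_def by blast+
    have L: "is_line (affine hull {w a, y})" "y \<in> affine hull {w a, y}"
      "w a \<in> affine hull {w a, y}" by (rule hull[OF n(1)])+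
    have x: "x \<in> affine hull {w a, y}" unfolding LL by (rule hull(2)[OF n(2)])
    then have "det2 (y - w a) (x - y) = 0" using mem_line_det2'[OF L(1,3,2) n(1)] by simp
    then have "(y - w a) \<bullet> (x - y) \<le> 0"
      using t that unfolding touches_def y hull_edge_def by blast
    then obtain c where c: "c > 0" "y - x = c *\<^sub>R (y - w a)"
      using same_direction[OF L x n] by blast
    have "det2 (y - x) (z' a - y) \<le> 0" "det2 (y - w a) (z' a - y) > 0"
      using t that unfolding touches_def y hull_edge_def by blast+
    then show False using c by (simp add: mult_le_0_iff)
  qed
  then have "F ` C \<inter> H = {}" using h01 h12 h23 by (auto simp: H_def)
  moreover have "finite (F ` C)" "finite H"
    using finite_subset[OF Ff finF] by (auto simp: H_def)
  ultimately have "card (F ` C \<union> H) = card C + 3"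
    using card_Un_disjoint cFC \<open>card H = 3\<close> by metis
  moreover have "card (F ` C \<union> H) \<le> card Flags"
    using Ff Hf finF by (intro card_mono) auto
  ultimately show ?thesis using cardF cardC by linarith
qed

section \<open>Counting bichromatic lines from a given line\<close>

text \<open>
  The points of \<open>X\<close> lie on \<open>L\<close>, and a line different from \<open>L\<close> meets \<open>L\<close> at most once.
\<close>

lemma card_meet_one:
  assumes "is_line L" "X \<subseteq> L" "Y \<inter> L = {}" "M \<in> joins X Y"
  shows "card (M \<inter> X) = 1"
proof -
  obtain x y where M: "is_line M" "x \<in> X" "x \<in> M" "y \<in> Y" "y \<in> M"
    using assms(4) by (auto simp: joins_def)
  have "M \<inter> X = {x}"
  proof (rule ccontr)
    assume "M \<inter> X \<noteq> {x}"
    then obtain x' where "x' \<in> M" "x' \<in> X" "x' \<noteq> x" using M by blast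
    then have "M = L" using line_unique[of M L x x'] M assms(1,2) by blast
    then show False using M assms(3) by blast
  qed
  then show ?thesis by simp
qed

lemma sum_joins_line:
  assumes "is_line L" "X \<subseteq> L" "Y \<inter> L = {}" "finite X" "finite Y"
  shows "(\<Sum>M\<in>joins X Y. card (M \<inter> Y)) = card X * card Y"
proof -
  have "X \<inter> Y = {}" using assms by blast
  from sum_joins[OF assms(4,5) this] show ?thesis
    using card_meet_one[OF assms(1-3)] by simp
qed

lemma line_through_exists:
  fixes v :: "real^2"
  obtains L where "is_line L" "v \<in> L"
proof -
  obtain w :: "real^2" where "w \<noteq> v"
    by (metis vector_choose_dist zero_le_one dist_self zero_neq_one)
  then show ?thesis using that[of "affine hull {v, w}"] is_line_hull[of v w] by (simp add: hull_inc)
qed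

lemma sum_joins_point:
  assumes "v \<notin> Y" "finite Y"
  shows "(\<Sum>M\<in>joins {v} Y. card (M \<inter> Y)) = card Y"
proof -
  have "card (M \<inter> {v}) = 1" if "M \<in> joins {v} Y" for M
  proof -
    have "M \<inter> {v} = {v}" using that by (auto simp: joins_def)
    then show ?thesis by simp
  qed
  then show ?thesis using sum_joins[of "{v}" Y] assms by simp
qed

text \<open>
  Each point of \<open>C\<close> sends \<open>card X\<close> different lines to \<open>X\<close>, and two points of \<open>C\<close> share at most one of
  these lines, namely the one that joins them.
\<close>

lemma card_joins_ge:
  assumes "is_line L" "X \<subseteq> L" "finite X" "finite C" "C \<inter> L = {}"
  shows "card X * card C \<le> card (joins X C) + (card C choose 2)"
  using assms(4,5)
proof (induction C)
  case empty
  then show ?case by simp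
next
  case (insert v C)
  have disj: "X \<inter> C = {}" "X \<inter> {v} = {}" "{v} \<inter> L = {}" "C \<inter> L = {}" using assms insert by auto
  have fin: "finite (joins X C)" "finite (joins X {v})" "finite (joins X (insert v C))"
    by (rule finite_joins; use assms insert disj in auto)+
  have "card (joins X {v}) = card X"
  proof -
    have "(\<Sum>M\<in>joins X {v}. card (M \<inter> {v})) = card X"
      using sum_joins_line[OF assms(1,2) disj(3) assms(3)] by simp
    moreover have "card (M \<inter> {v}) = 1" if "M \<in> joins X {v}" for M
    proof -
      have "M \<inter> {v} = {v}" using that by (auto simp: joins_def)
      then show ?thesis by simp
    qed
    ultimately show ?thesis by simp
  qed
  moreover have "card (joins X {v} \<inter> joins X C) \<le> card C"
  proof -
    have "joins X {v} \<inter> joins X C \<subseteq> (\<lambda>w. affine hull {v, w}) ` C"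
    proof
      fix M assume "M \<in> joins X {v} \<inter> joins X C"
      then obtain w where "is_line M" "v \<in> M" "w \<in> C" "w \<in> M" by (auto simp: joins_def)
      moreover from this have "v \<noteq> w" using insert.hyps by auto
      ultimately show "M \<in> (\<lambda>w. affine hull {v, w}) ` C" using line_eq_hull by blast
    qed
    then show ?thesis using insert.hyps by (meson card_image_le card_mono finite_imageI le_trans)
  qed
  moreover have "card (joins X {v} \<union> joins X C) \<le> card (joins X (insert v C))"
    by (intro card_mono fin) (auto simp: joins_def)
  moreover have "card (joins X {v}) + card (joins X C) = card (joins X {v} \<union> joins X C) + card (joins X {v} \<inter> joins X C)"
    using fin by (intro card_Un_Int)
  moreover have "card X * card C \<le> card (joins X C) + (card C choose 2)"
    using insert.IH disj by blast
  moreover have "card (insert v C) = Suc (card C)" using insert.hyps by simp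
  moreover have "(Suc (card C) choose 2) = (card C choose 2) + card C"
    by (simp add: numeral_2_eq_2)
  ultimately show ?case by simp
qed

lemma card_joins_ge_sub:
  assumes "is_line L" "X \<subseteq> L" "finite X" "finite C" "C \<inter> L = {}" "m \<le> card C"
  shows "card X * m \<le> card (joins X C) + (m choose 2)"
proof -
  obtain D where D: "D \<subseteq> C" "card D = m" "finite D"
    using obtain_subset_with_card_n[OF assms(6)] by metis
  have "card X * m \<le> card (joins X D) + (m choose 2)"
    using card_joins_ge[OF assms(1-3) D(3)] D assms by blast
  moreover have "card (joins X D) \<le> card (joins X C)"
    by (intro card_mono finite_joins joins_mono) (use assms D in auto)
  ultimately show ?thesis by linarith
qed

text \<open>
  A line other than \<open>L\<close> meets \<open>L\<close> at most once; so it cannot pass through a red and a blue point of \<open>L\<close>,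
  which makes the two families of lines disjoint.
\<close>

lemma card_joins_split:
  assumes "finite R" "finite B" "R \<inter> B = {}" "L \<in> joins R B"
  shows "card (joins R B) \<ge> 1 + card (joins (R \<inter> L) (B - L)) + card (joins (B \<inter> L) (R - L))"
    and "joins (R \<inter> L) (B - L) \<union> joins (B \<inter> L) (R - L) \<subseteq> joins R B - {L}"
    and "joins (R \<inter> L) (B - L) \<inter> joins (B \<inter> L) (R - L) = {}"
proof -
  let ?J = "joins (R \<inter> L) (B - L)" and ?K = "joins (B \<inter> L) (R - L)"
  have L: "is_line L" using assms by (simp add: joins_def)
  show sub: "?J \<union> ?K \<subseteq> joins R B - {L}" by (auto simp: joins_def)
  show disj: "?J \<inter> ?K = {}"
  proof (rule ccontr)
    assume "?J \<inter> ?K \<noteq> {}"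
    then obtain M x y where "is_line M" "x \<in> R" "x \<in> L" "x \<in> M" "y \<in> B" "y \<in> L" "y \<in> M" "M \<noteq> L"
      by (auto simp: joins_def)
    then show False using line_unique[OF L, of M x y] assms(3) by blast
  qed
  have fin: "finite ?J" "finite ?K" "finite (joins R B)"
    by (rule finite_joins; use assms in auto)+
  have "card (?J \<union> ?K) \<le> card (joins R B - {L})"
    using fin sub by (intro card_mono) auto
  also have "\<dots> = card (joins R B) - 1" using assms(4) fin by simp
  finally have "card ?J + card ?K \<le> card (joins R B) - 1"
    using disj fin by (simp add: card_Un_disjoint)
  moreover have "card (joins R B) > 0" using assms(4) fin by (auto simp: card_gt_0_iff)
  ultimately show "card (joins R B) \<ge> 1 + card ?J + card ?K" by linarith
qed

lemma joins_line_bound: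
  assumes "finite R" "finite B" "R \<inter> B = {}" "L \<in> joins R B" "c \<le> card (B - L)" "a \<le> card (R - L)"
  shows "1 + card (R \<inter> L) * c + card (B \<inter> L) * a \<le> card (joins R B) + (c choose 2) + (a choose 2)"
proof -
  have L: "is_line L" using assms by (simp add: joins_def)
  have "card (R \<inter> L) * c \<le> card (joins (R \<inter> L) (B - L)) + (c choose 2)"
    "card (B \<inter> L) * a \<le> card (joins (B \<inter> L) (R - L)) + (a choose 2)"
    by (rule card_joins_ge_sub[OF L]; use assms in auto)+
  then show ?thesis using card_joins_split(1)[OF assms(1-4)] by linarith
qed

text \<open>
  If \<open>L\<close> is bichromatic, the lines that join the two exceptional points to the points of the other
  colour on \<open>L\<close> suffice together with \<open>L\<close>.  If \<open>L\<close> is monochromatic, the two exceptional points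
  have the same colour and \<open>L\<close> carries exactly the points of the other colour.
\<close>

lemma two_points_off_line:
  assumes "finite R" "finite B" "R \<inter> B = {}" "is_line L" "card ((R \<union> B) - L) = 2"
    and "card R + card B \<ge> 4" "card R \<le> card B + 1" "card B \<le> card R + 1"
  shows "card R + card B \<le> card (joins R B) + 1"
proof -
  note on_off = card_Int_Diff[OF assms(1), of L] card_Int_Diff[OF assms(2), of L]
  have "(R \<union> B) - L = (R - L) \<union> (B - L)" by blast
  then have two: "card (R - L) + card (B - L) = 2"
    using assms card_Un_disjoint[of "R - L" "B - L"] by (simp add: Diff_Int_distrib2 Int_Diff disjoint_iff)
  have mono: ?thesis
    if fin: "finite X" "finite Y" "X \<inter> Y = {}" and "card (X - L) + card (Y - L) = 2" "X \<inter> L = {}"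
      and b: "card X + card Y \<ge> 4" "card Y \<le> card X + 1"
      and eq: "card R + card B = card X + card Y" "joins R B = joins Y X" for X Y
  proof -
    have "X - L = X" using that by blast
    then have "card X \<le> 2" using that by simp
    then have "card X = 2" using b by linarith
    then have "card (Y - L) = 0" using that \<open>X - L = X\<close> by simp
    then have "Y \<subseteq> L" using fin by auto
    have "card Y * card X \<le> card (joins Y X) + (card X choose 2)"
      by (rule card_joins_ge[OF assms(4) \<open>Y \<subseteq> L\<close>]) (use that in auto)
    then show ?thesis using \<open>card X = 2\<close> b eq by simp
  qed
  show ?thesis
  proof (cases "L \<in> joins R B")
    case False
    then consider "R \<inter> L = {}" | "B \<inter> L = {}" using assms(4) by (auto simp: joins_def)
    then show ?thesis
    proof cases
      case 1
      then show ?thesis using mono[of R B] assms two by (simp add: joins_commute)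
    next
      case 2
      then show ?thesis using mono[of B R] assms two by (simp add: Int_commute add.commute)
    qed
  next
    case True
    note bd = joins_line_bound[OF assms(1-3) True]
    have "R \<inter> L \<noteq> {}" "B \<inter> L \<noteq> {}" using True by (auto simp: joins_def)
    then have pos: "card (R \<inter> L) \<ge> 1" "card (B \<inter> L) \<ge> 1"
      using assms by (auto simp: Suc_le_eq card_gt_0_iff)
    from two consider "card (R - L) = 0" "card (B - L) = 2" | "card (R - L) = 1" "card (B - L) = 1"
      | "card (R - L) = 2" "card (B - L) = 0" by linarith
    then show ?thesis
    proof cases
      case 1 then show ?thesis using bd[of 2 0] on_off assms(7,8) pos by (simp add: binomial_eq_0)
    next
      case 2 then show ?thesis using bd[of 1 1] on_off assms(7,8) pos by (simp add: binomial_eq_0)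
    next
      case 3 then show ?thesis using bd[of 0 2] on_off assms(7,8) pos by (simp add: binomial_eq_0)
    qed
  qed
qed

section \<open>Two triangles in several perspectives\<close>

text \<open>
  Twice the signed area of the triangle \<open>p q r\<close>.
\<close>

definition area :: "real^2 \<Rightarrow> real^2 \<Rightarrow> real^2 \<Rightarrow> real" where
  "area p q r = det2 (q - p) (r - p)"

lemma area_zero_iff: "p \<noteq> q \<Longrightarrow> area p q r = 0 \<longleftrightarrow> r \<in> affine hull {p, q}"
  by (simp add: area_def mem_hull_det2)

lemma area_sum: "area a2 a3 x + area a3 a1 x + area a1 a2 x = area a1 a2 a3"
  by (simp add: area_def det2_def algebra_simps)

text \<open>
  The areas of \<open>a2 a3 x\<close>, \<open>a3 a1 x\<close> and \<open>a1 a2 x\<close> are barycentric coordinates of \<open>x\<close>.  If \<open>x\<close> and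
  \<open>q\<close> are collinear with \<open>a1\<close>, the right-hand side vanishes and their second and third coordinates
  are proportional.
\<close>

lemma area_cevian:
  "area a3 a1 x * area a1 a2 q - area a1 a2 x * area a3 a1 q = - (area a1 a2 a3 * area a1 q x)"
  unfolding area_def det2_def vector_minus_component by algebra

text \<open>
  This is the multiplied out condition that the lines \<open>a1 x\<close>, \<open>a2 y\<close> and \<open>a3 z\<close> pass through a common
  point \<open>q\<close>: the three proportions of \<open>area_cevian\<close> are multiplied and the coordinates of \<open>q\<close> cancel.
\<close>

lemma ceva:
  assumes "area a1 q x = 0" "area a2 q y = 0" "area a3 q z = 0"
    and "area a2 a3 q \<noteq> 0" "area a3 a1 q \<noteq> 0" "area a1 a2 q \<noteq> 0"
  shows "area a3 a1 x * area a1 a2 y * area a2 a3 z = area a1 a2 x * area a2 a3 y * area a3 a1 z"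
proof -
  have "area a3 a1 x * area a1 a2 q = area a1 a2 x * area a3 a1 q"
    "area a1 a2 y * area a2 a3 q = area a2 a3 y * area a1 a2 q"
    "area a2 a3 z * area a3 a1 q = area a3 a1 z * area a2 a3 q"
    using area_cevian[of a3 a1 x a2 q] area_cevian[of a1 a2 y a3 q] area_cevian[of a2 a3 z a1 q] assms by auto
  then have "(area a3 a1 x * area a1 a2 y * area a2 a3 z) * (area a2 a3 q * area a3 a1 q * area a1 a2 q)
    = (area a1 a2 x * area a2 a3 y * area a3 a1 z) * (area a2 a3 q * area a3 a1 q * area a1 a2 q)"
    by algebra
  then show ?thesis using assms(4-6) by simp
qed

text \<open>
  The product of the conditions for the three cyclic arrangements of \<open>p\<close>, \<open>q\<close> and \<open>r\<close> is an identity, so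
  two of them imply the third one.
\<close>

lemma cyclic_third:
  fixes \<alpha> \<beta> \<gamma> :: "'a \<Rightarrow> real"
  assumes "\<And>x. x \<in> {p, q, r} \<Longrightarrow> \<alpha> x \<noteq> 0 \<and> \<beta> x \<noteq> 0 \<and> \<gamma> x \<noteq> 0"
    and "\<beta> p * \<gamma> q * \<alpha> r = \<gamma> p * \<alpha> q * \<beta> r" "\<beta> q * \<gamma> r * \<alpha> p = \<gamma> q * \<alpha> r * \<beta> p"
  shows "\<beta> r * \<gamma> p * \<alpha> q = \<gamma> r * \<alpha> p * \<beta> q"
proof -
  have "(\<beta> r * \<gamma> p * \<alpha> q) * ((\<beta> p * \<gamma> q * \<alpha> r) * (\<beta> q * \<gamma> r * \<alpha> p))
      = (\<gamma> r * \<alpha> p * \<beta> q) * ((\<gamma> p * \<alpha> q * \<beta> r) * (\<gamma> q * \<alpha> r * \<beta> p))"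
    by (simp add: mult_ac)
  then have "(\<beta> r * \<gamma> p * \<alpha> q) * ((\<beta> p * \<gamma> q * \<alpha> r) * (\<beta> q * \<gamma> r * \<alpha> p))
      = (\<gamma> r * \<alpha> p * \<beta> q) * ((\<beta> p * \<gamma> q * \<alpha> r) * (\<beta> q * \<gamma> r * \<alpha> p))"
    unfolding assms(2,3) .
  then show ?thesis using assms(1) by simp
qed

lemma cube_root_one: "t = 1" if "t ^ 3 = 1" for t :: real
  using that by (metis odd_numeral power_one odd_real_root_power_cancel)

text \<open>
  In terms of the ratios \<open>u\<close>, \<open>v\<close>, \<open>w\<close> of coordinates the six conditions say \<open>u x * v y * w z = 1\<close> for all
  arrangements, while \<open>u x * v x * w x = 1\<close> for every \<open>x\<close>.  Hence passing from \<open>p\<close> to \<open>q\<close>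
  multiplies all three ratios by the same number \<open>t\<close>, and \<open>t\<^sup>3 = 1\<close>.
\<close>

lemma six_perspectivities_real:
  fixes \<alpha> \<beta> \<gamma> :: "'a \<Rightarrow> real"
  assumes nz: "\<And>x. x \<in> {p, q, r} \<Longrightarrow> \<alpha> x \<noteq> 0 \<and> \<beta> x \<noteq> 0 \<and> \<gamma> x \<noteq> 0"
    and g: "\<And>x y z. {x, y, z} = {p, q, r} \<Longrightarrow> \<beta> x * \<gamma> y * \<alpha> z = \<gamma> x * \<alpha> y * \<beta> z"
  shows "\<beta> p * \<gamma> q = \<beta> q * \<gamma> p" "\<gamma> p * \<alpha> q = \<gamma> q * \<alpha> p"
proof -
  define u where "u = (\<lambda>x. \<beta> x / \<gamma> x)"
  define v where "v = (\<lambda>x. \<gamma> x / \<alpha> x)"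
  define w where "w = (\<lambda>x. \<alpha> x / \<beta> x)"
  have uvw: "u x * v y * w z = 1" if "{x, y, z} = {p, q, r}" for x y z
    using nz[of x] nz[of y] nz[of z] g[OF that] that by (auto simp: u_def v_def w_def field_simps)
  have one: "u x * v x * w x = 1" if "x \<in> {p, q, r}" for x
    using nz[OF that] by (simp add: u_def v_def w_def)
  have nz': "u x \<noteq> 0" "v x \<noteq> 0" "w x \<noteq> 0" if "x \<in> {p, q, r}" for x
    using nz[OF that] by (simp_all add: u_def v_def w_def)
  define t where "t = v q / v p"
  have vq: "v q = t * v p" using nz' by (simp add: t_def)
  have "u p * v q * w r = 1" "u q * v p * w r = 1" by (rule uvw; blast)+
  then have "u p * v q * w r = u q * v p * w r" by simp
  then have uq: "u q = t * u p" using nz' vq by (simp add: mult.commute)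
  have "u r * v p * w q = 1" "u r * v q * w p = 1" by (rule uvw; blast)+
  then have "u r * v p * w q = u r * v q * w p" by simp
  then have wq: "w q = t * w p" using nz' vq by simp
  have "t ^ 3 * (u p * v p * w p) = u q * v q * w q"
    unfolding vq uq wq by (simp add: power3_eq_cube)
  then have "t ^ 3 = 1" using one[of p] one[of q] by simp
  then have "t = 1" by (rule cube_root_one)
  then have "u p = u q" "v p = v q" using uq vq by auto
  then show "\<beta> p * \<gamma> q = \<beta> q * \<gamma> p" "\<gamma> p * \<alpha> q = \<gamma> q * \<alpha> p"
    using nz[of p] nz[of q] by (simp_all add: u_def v_def field_simps)
qed

text \<open>
  Proportional barycentric coordinates are equal, because their sum is the area of the
  triangle by \<open>area_sum\<close>.
\<close>

lemma barycentric_inj: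
  assumes D: "area a1 a2 a3 \<noteq> 0"
    and nz: "area a3 a1 x \<noteq> 0" "area a1 a2 x \<noteq> 0" "area a2 a3 x \<noteq> 0"
    and "area a3 a1 x * area a1 a2 y = area a3 a1 y * area a1 a2 x"
    and "area a1 a2 x * area a2 a3 y = area a1 a2 y * area a2 a3 x"
  shows "x = y"
proof -
  define t where "t = area a1 a2 y / area a1 a2 x"
  have 1: "area a1 a2 y = t * area a1 a2 x" using nz by (simp add: t_def)
  then have 2: "area a3 a1 y = t * area a3 a1 x" "area a2 a3 y = t * area a2 a3 x"
    using assms by (auto simp: mult.commute)
  have "area a1 a2 a3 = t * area a1 a2 a3"
    using area_sum[of a2 a3 x a1] area_sum[of a2 a3 y a1] unfolding 1 2 by (simp add: distrib_left[symmetric])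
  then have "t = 1" using D by simp
  then have eq: "area a1 a2 x = area a1 a2 y" "area a3 a1 x = area a3 a1 y" using 1 2 by auto
  have "area a1 a2 a3 * (x$1 - y$1) = (area a1 a2 x - area a1 a2 y) * (a3$1 - a1$1) + (area a3 a1 x - area a3 a1 y) * (a2$1 - a1$1)"
    "area a1 a2 a3 * (x$2 - y$2) = (area a1 a2 x - area a1 a2 y) * (a3$2 - a1$2) + (area a3 a1 x - area a3 a1 y) * (a2$2 - a1$2)"
    unfolding area_def det2_def vector_minus_component by algebra+
  then have "area a1 a2 a3 * (x$1 - y$1) = 0" "area a1 a2 a3 * (x$2 - y$2) = 0"
    using eq by simp_all
  then show "x = y" using D by (simp add: vec2_eq_iff)
qed

text \<open>
  The points of \<open>Q\<close> are centres of perspectivities of the triangle \<open>a1 a2 a3\<close> with the triangle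
  \<open>b1 b2 b3\<close>, for five different assignments of the vertices.  Of the three assignments in each
  cyclic class at least two occur, so by \<open>cyclic_third\<close> all six satisfy Ceva's condition.
\<close>

lemma five_perspectivities:
  fixes a1 a2 a3 b1 b2 b3 :: "real^2" and Q :: "(real^2) set" and m :: "real^2 \<Rightarrow> real^2 \<Rightarrow> real^2"
  assumes D: "area a1 a2 a3 \<noteq> 0" and b: "b1 \<noteq> b2" "b1 \<noteq> b3" "b2 \<noteq> b3"
    and nz: "\<And>x. x \<in> {b1, b2, b3} \<union> Q \<Longrightarrow> area a2 a3 x \<noteq> 0 \<and> area a3 a1 x \<noteq> 0 \<and> area a1 a2 x \<noteq> 0"
    and m: "\<And>q. q \<in> Q \<Longrightarrow> {m q a1, m q a2, m q a3} = {b1, b2, b3}"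
    and col: "\<And>q a. q \<in> Q \<Longrightarrow> a \<in> {a1, a2, a3} \<Longrightarrow> area a q (m q a) = 0"
    and inj: "inj_on (\<lambda>q. (m q a1, m q a2, m q a3)) Q"
    and "card Q = 5"
  shows False
proof -
  define \<alpha> where "\<alpha> = area a2 a3"
  define \<beta> where "\<beta> = area a3 a1"
  define \<gamma> where "\<gamma> = area a1 a2"
  define f where "f = (\<lambda>q. (m q a1, m q a2, m q a3))"
  define G where "G = {(x, y, z). \<beta> x * \<gamma> y * \<alpha> z = \<gamma> x * \<alpha> y * \<beta> z}"
  define S where "S = {(b1,b2,b3), (b2,b3,b1), (b3,b1,b2), (b1,b3,b2), (b3,b2,b1), (b2,b1,b3)}"
  have nz': "\<alpha> x \<noteq> 0 \<and> \<beta> x \<noteq> 0 \<and> \<gamma> x \<noteq> 0" if "x \<in> {b1, b2, b3}" for x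
    using nz[of x] that unfolding \<alpha>_def \<beta>_def \<gamma>_def by blast
  have dist: "x \<noteq> y" "y \<noteq> z" "x \<noteq> z" if "{x, y, z} = {b1, b2, b3}" for x y z
  proof -
    have "card {x, y, z} = 3" unfolding that using b by simp
    then show "x \<noteq> y" "y \<noteq> z" "x \<noteq> z" by (auto simp: card_insert_if split: if_splits)
  qed
  have S: "(x, y, z) \<in> S" if "{x, y, z} = {b1, b2, b3}" for x y z
  proof -
    have "x \<in> {b1,b2,b3}" "y \<in> {b1,b2,b3}" "z \<in> {b1,b2,b3}" unfolding that[symmetric] by blast+
    then show ?thesis using dist[OF that] unfolding S_def by blast
  qed
  have "f ` Q \<subseteq> S \<inter> G"
  proof (intro image_subsetI IntI)
    fix q assume q: "q \<in> Q"
    show "f q \<in> S" unfolding f_def by (rule S[OF m[OF q]])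
    have "area a2 a3 q \<noteq> 0" "area a3 a1 q \<noteq> 0" "area a1 a2 q \<noteq> 0" using nz[of q] q by blast+
    then show "f q \<in> G"
      unfolding f_def G_def \<alpha>_def \<beta>_def \<gamma>_def using ceva[OF col[OF q] col[OF q] col[OF q]] by simp
  qed
  moreover have "card (f ` Q) = 5" using inj \<open>card Q = 5\<close> by (simp add: card_image f_def)
  moreover have finS: "finite S" by (simp add: S_def)
  ultimately have 5: "card (S \<inter> G) \<ge> 5" using card_mono[of "S \<inter> G" "f ` Q"] by simp
  have "S = set [(b1,b2,b3), (b2,b3,b1), (b3,b1,b2), (b1,b3,b2), (b3,b2,b1), (b2,b1,b3)]"
    by (simp only: S_def list.set)
  then have "card S \<le> length [(b1,b2,b3), (b2,b3,b1), (b3,b1,b2), (b1,b3,b2), (b3,b2,b1), (b2,b1,b3)]"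
    by (simp only: card_length)
  then have "card S \<le> 6" by simp
  have two: "s \<in> G \<or> t \<in> G" if "s \<in> S" "t \<in> S" "s \<noteq> t" for s t
  proof (rule ccontr)
    assume "\<not> ?thesis"
    then have "S \<inter> G \<subseteq> S - {s, t}" by blast
    then have "card (S \<inter> G) \<le> card (S - {s, t})" using finS by (intro card_mono) auto
    also have "\<dots> = card S - 2" using that finS by (subst card_Diff_subset) auto
    finally show False using 5 \<open>card S \<le> 6\<close> by simp
  qed
  have cyc: "(z, x, y) \<in> G" if "{x, y, z} = {b1, b2, b3}" "(x, y, z) \<in> G" "(y, z, x) \<in> G" for x y z
  proof -
    have "\<And>w. w \<in> {x, y, z} \<Longrightarrow> \<alpha> w \<noteq> 0 \<and> \<beta> w \<noteq> 0 \<and> \<gamma> w \<noteq> 0"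
      unfolding that(1) by (rule nz')
    note cyclic_third[OF this]
    then show ?thesis using that(2,3) by (simp add: G_def)
  qed
  have all: "(x, y, z) \<in> G" if xyz: "{x, y, z} = {b1, b2, b3}" for x y z
  proof (rule ccontr)
    assume no: "(x, y, z) \<notin> G"
    have perm: "{y, z, x} = {b1, b2, b3}" "{z, x, y} = {b1, b2, b3}"
      unfolding xyz[symmetric] by blast+
    have "(x, y, z) \<noteq> (y, z, x)" "(x, y, z) \<noteq> (z, x, y)" using dist[OF xyz] by simp_all
    then have "(y, z, x) \<in> G" "(z, x, y) \<in> G"
      using two[OF S[OF xyz] S[OF perm(1)]] two[OF S[OF xyz] S[OF perm(2)]] no by blast+
    then show False using cyc[OF perm(1)] no by blast
  qed
  have g: "\<beta> x * \<gamma> y * \<alpha> z = \<gamma> x * \<alpha> y * \<beta> z" if "{x, y, z} = {b1, b2, b3}" for x y z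
    using all[OF that] by (simp add: G_def)
  note six = six_perspectivities_real[of b1 b2 b3 \<alpha> \<beta> \<gamma>, OF nz' g]
  have "b1 = b2"
    using barycentric_inj[OF D, of b1 b2] nz' six unfolding \<alpha>_def \<beta>_def \<gamma>_def by blast
  then show False using b by simp
qed

section \<open>Six red and five blue points\<close>

text \<open>
  Each blue point \<open>q\<close> pairs off the six red points by the lines through it; let \<open>m q r\<close> be the partner of
  the red point \<open>r\<close>.  Counting shows that every red point has exactly three partners, two of which are
  attained by two blue points each.  Since two different blue points agree on at most one pair, the graph
  of all pairs must be the complete bipartite graph between two triples of red points, and every blue point
  is the centre of a perspectivity between these two triangles.
\<close>

lemma no_six_five_configuration:
  assumes finR: "finite R" and finB: "finite B" and disj: "R \<inter> B = {}"
    and cardR: "card R = 6" and cardB: "card B = 5"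
    and two_red: "\<And>L. L \<in> joins R B \<Longrightarrow> card (L \<inter> R) = 2"
    and blue_le2: "\<And>L. L \<in> joins R B \<Longrightarrow> card (L \<inter> B) \<le> 2"
    and nine: "card (joins R B) = 9"
    and general: "\<And>L. is_line L \<Longrightarrow> card (L \<inter> R) \<le> 2"
  shows False
proof -
  have ne: "q \<noteq> r" if "q \<in> B" "r \<in> R" for q r using that disj by blast
  have H: "is_line (affine hull {x, y})" "x \<in> affine hull {x, y}" "y \<in> affine hull {x, y}"
    if "x \<noteq> y" for x y :: "real^2"
    using that by (auto intro: is_line_hull hull_inc)
  have hullJ: "affine hull {q, r} \<in> joins R B" if "q \<in> B" "r \<in> R" for q r
    by (rule joinsI[OF H(1) that(2) H(3) that(1) H(2)]) (use ne[OF that] in auto)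
  have "\<exists>s. s \<noteq> r \<and> affine hull {q, r} \<inter> R = {r, s}" if "q \<in> B" "r \<in> R" for q r
  proof -
    have "card (affine hull {q, r} \<inter> R) = 2" using two_red hullJ that by blast
    moreover have "r \<in> affine hull {q, r} \<inter> R" using that by (simp add: hull_inc)
    moreover obtain x y where xy: "affine hull {q, r} \<inter> R = {x, y}" "x \<noteq> y"
      using \<open>card (affine hull {q, r} \<inter> R) = 2\<close> by (auto simp: card_2_iff)
    ultimately have "r = x \<or> r = y" by blast
    then show ?thesis
    proof
      assume "r = x"
      then show ?thesis using xy by (intro exI[of _ y]) simp
    next
      assume "r = y"
      then show ?thesis using xy by (intro exI[of _ x]) (simp add: insert_commute)
    qed
  qed
  then obtain m where m: "\<And>q r. q \<in> B \<Longrightarrow> r \<in> R \<Longrightarrow> m q r \<noteq> r"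
      "\<And>q r. q \<in> B \<Longrightarrow> r \<in> R \<Longrightarrow> affine hull {q, r} \<inter> R = {r, m q r}"
    by metis
  have mR: "m q r \<in> R" and mH: "m q r \<in> affine hull {q, r}" if "q \<in> B" "r \<in> R" for q r
    using m(2)[OF that] by blast+
  have m_unique: "m q r = s" if "q \<in> B" "r \<in> R" "s \<in> R" "s \<noteq> r" "s \<in> affine hull {q, r}" for q r s
    using m(2)[OF that(1,2)] that(3-5) by blast
  have invol: "m q (m q r) = r" if q: "q \<in> B" and r: "r \<in> R" for q r
  proof (rule m_unique[OF q mR[OF q r] r])
    show "r \<noteq> m q r" using m(1)[OF q r] by simp
    have "affine hull {q, r} = affine hull {q, m q r}"
      using ne[OF q r] ne[OF q mR[OF q r]] mH[OF q r] H[of q r]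
      by (intro line_eq_hull[OF H(1)]) auto
    then show "r \<in> affine hull {q, m q r}" using H(3)[OF ne[OF q r]] by simp
  qed
  have q_on: "q \<in> affine hull {r, m q r}" if q: "q \<in> B" and r: "r \<in> R" for q r
  proof -
    have "affine hull {q, r} = affine hull {r, m q r}"
      using m(1)[OF q r] mH[OF q r] H[OF ne[OF q r]] by (intro line_eq_hull) auto
    then show ?thesis using H(2)[OF ne[OF q r]] by simp
  qed
  \<comment> \<open>on a common pair both blue points lie on the line of that pair; two common pairs
    would lie on the same line through \<open>q\<close> and \<open>q'\<close>\<close>
  have agree: "r' = r \<or> r' = m q r"
    if q: "q \<in> B" "q' \<in> B" "q \<noteq> q'" and r: "r \<in> R" "r' \<in> R"
      and eq: "m q r = m q' r" "m q r' = m q' r'" for q q' r r'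
  proof -
    note l = H[OF m(1)[OF q(1) r(1), symmetric]] and l' = H[OF m(1)[OF q(1) r(2), symmetric]]
    have "affine hull {r, m q r} = affine hull {r', m q r'}"
    proof (rule line_unique[OF l(1) l'(1) _ _ _ _ q(3)])
      show "q \<in> affine hull {r, m q r}" "q \<in> affine hull {r', m q r'}"
        using q_on q r by blast+
      show "q' \<in> affine hull {r, m q r}" "q' \<in> affine hull {r', m q r'}"
        unfolding eq using q_on q r by blast+
    qed
    then have "r' \<in> affine hull {r, m q r}" using l'(2) by simp
    moreover have "affine hull {q, r} = affine hull {r, m q r}"
      using m(1)[OF q(1) r(1)] mH[OF q(1) r(1)] H[OF ne[OF q(1) r(1)]] by (intro line_eq_hull) auto
    ultimately show ?thesis using m(2)[OF q(1) r(1)] r(2) by blast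
  qed
  define N where "N = (\<lambda>r. (\<lambda>q. m q r) ` B)"
  define fib where "fib = (\<lambda>r s. {q \<in> B. m q r = s})"
  have finN: "finite (N r)" for r using finB by (simp add: N_def)
  have fib_le2: "card (fib r s) \<le> 2" if r: "r \<in> R" for r s
  proof (cases "fib r s = {}")
    case False
    then obtain q where q: "q \<in> B" "m q r = s" by (auto simp: fib_def)
    have "fib r s \<subseteq> affine hull {q, r} \<inter> B"
    proof
      fix p assume "p \<in> fib r s"
      then have p: "p \<in> B" "m p r = s" by (auto simp: fib_def)
      have "affine hull {q, r} = affine hull {r, s}"
        using m(1)[OF q(1) r] mH[OF q(1) r] H[OF ne[OF q(1) r]] q by (intro line_eq_hull) auto
      then show "p \<in> affine hull {q, r} \<inter> B" using q_on[OF p(1) r] p by simp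
    qed
    then have "card (fib r s) \<le> card (affine hull {q, r} \<inter> B)" using finB by (intro card_mono) auto
    then show ?thesis using blue_le2[OF hullJ[OF q(1) r]] by linarith
  qed simp
  have sumN: "(\<Sum>s\<in>N r. card (fib r s)) = 5" for r
  proof -
    have "card B = card (\<Union>s\<in>N r. fib r s)" by (rule arg_cong[of _ _ card]) (auto simp: N_def fib_def)
    also have "\<dots> = (\<Sum>s\<in>N r. card (fib r s))"
      by (rule card_UN_disjoint) (use finN finB in \<open>auto simp: fib_def\<close>)
    finally show ?thesis using cardB by simp
  qed
  \<comment> \<open>a red point lies on at least three bichromatic lines, as each carries at most
    two of the five blue points; the degrees sum to \<open>2 * 9 = 6 * 3\<close>, so all are equal
    to three\<close>
  have N_le3: "card (N r) \<le> 3" if r: "r \<in> R" for r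
  proof -
    have fin: "finite (joins {x} B)" if "x \<in> R" for x
      using that disj finB by (intro finite_joins) auto
    have deg: "3 \<le> card (joins {x} B)" if x: "x \<in> R" for x
    proof -
      have "5 = (\<Sum>M\<in>joins {x} B. card (M \<inter> B))" using sum_joins_point[of x B] x disj finB cardB by auto
      also have "\<dots> \<le> (\<Sum>M\<in>joins {x} B. 2)"
        using x by (intro sum_mono blue_le2) (auto simp: joins_def)
      finally show ?thesis by simp
    qed
    have eq: "joins {x} B = {M \<in> joins R B. x \<in> M}" if "x \<in> R" for x
      using that by (auto simp: joins_def)
    have "(\<Sum>x\<in>R. card {M \<in> joins R B. x \<in> M}) = (\<Sum>M\<in>joins R B. 2)"
    proof (rule sum_multicount_gen[OF finR finite_joins[OF finR finB disj]], intro ballI)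
      fix M assume "M \<in> joins R B"
      moreover have "{x \<in> R. x \<in> M} = M \<inter> R" by blast
      ultimately show "card {x \<in> R. x \<in> M} = 2" using two_red by simp
    qed
    then have "(\<Sum>x\<in>R. card (joins {x} B)) = 18" using nine eq by simp
    then have "card (joins {r} B) + (\<Sum>x\<in>R - {r}. card (joins {x} B)) = 18"
      using sum.remove[OF finR r] by metis
    moreover have "(\<Sum>x\<in>R - {r}. 3) \<le> (\<Sum>x\<in>R - {r}. card (joins {x} B))"
      by (intro sum_mono deg) auto
    moreover have "card (R - {r}) = 5" using r cardR finR by simp
    ultimately have "card (joins {r} B) \<le> 3" by simp
    moreover have "N r \<subseteq> (\<lambda>M. THE s. M \<inter> R = {r, s}) ` joins {r} B"
    proof
      fix s assume "s \<in> N r"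
      then obtain q where q: "q \<in> B" "s = m q r" by (auto simp: N_def)
      have "(THE t. affine hull {q, r} \<inter> R = {r, t}) = s"
        unfolding m(2)[OF q(1) r] using m(1)[OF q(1) r] q(2) by (intro the_equality) (auto simp: doubleton_eq_iff)
      moreover have "affine hull {q, r} \<in> joins {r} B"
        using hullJ[OF q(1) r] q(1) by (auto simp: joins_def hull_inc)
      ultimately show "s \<in> (\<lambda>M. THE s. M \<inter> R = {r, s}) ` joins {r} B" by blast
    qed
    then have "card (N r) \<le> card (joins {r} B)"
      using fin[OF r] by (meson card_image_le card_mono finite_imageI le_trans)
    ultimately show ?thesis by linarith
  qed
  have N_eq: "N r = T" if "r \<in> R" "T \<subseteq> N r" "card T = 3" for r T
    using card_seteq[OF finN that(2)] N_le3[OF that(1)] that(3) by simp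
  have NI: "q \<in> B \<Longrightarrow> m q r \<in> N r" for q r by (simp add: N_def)
  obtain a where a: "a \<in> R" using cardR by fastforce
  \<comment> \<open>five blue points, at most two for each of the at most three partners of
    \<open>a\<close>\<close>
  obtain b1 b2 where b12: "b1 \<in> N a" "b2 \<in> N a" "b1 \<noteq> b2" "card (fib a b1) = 2" "card (fib a b2) = 2"
    and "card (N a) = 3"
  proof -
    have "(\<Sum>s\<in>N a. card (fib a s)) \<le> (\<Sum>s\<in>N a. 2)" by (intro sum_mono fib_le2 a)
    then have "card (N a) = 3" using N_le3[OF a] sumN[of a] by simp
    then obtain x y z where N: "N a = {x, y, z}" "x \<noteq> y" "y \<noteq> z" "x \<noteq> z" by (auto simp: card_3_iff)
    then have "card (fib a x) + card (fib a y) + card (fib a z) = 5" using sumN[of a] by simp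
    then consider "card (fib a x) = 2" "card (fib a y) = 2" | "card (fib a x) = 2" "card (fib a z) = 2"
      | "card (fib a y) = 2" "card (fib a z) = 2"
      using fib_le2[OF a, of x] fib_le2[OF a, of y] fib_le2[OF a, of z] by linarith
    then show ?thesis
      using that N \<open>card (N a) = 3\<close> by cases auto
  qed
  have "card (N a - {b1, b2}) = 1" using b12 \<open>card (N a) = 3\<close> finN by (simp add: card_Diff_subset)
  then obtain b3 where "N a - {b1, b2} = {b3}" by (auto simp: card_1_singleton_iff)
  then have Na: "N a = {b1, b2, b3}" and b3: "b3 \<noteq> b1" "b3 \<noteq> b2" using b12 by blast+
  have Nsub: "N r \<subseteq> R - {r}" if "r \<in> R" for r using mR m(1) that by (auto simp: N_def)
  have bR: "b1 \<in> R" "b2 \<in> R" "b3 \<in> R" and ba: "b1 \<noteq> a" "b2 \<noteq> a" "b3 \<noteq> a"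
    using Nsub[OF a] Na by blast+
  have "card (R - {a, b1, b2, b3}) = 2"
    using cardR a bR ba b3 b12(3) finR by (subst card_Diff_subset) auto
  then obtain c d where "R - {a, b1, b2, b3} = {c, d}" and cd: "c \<noteq> d" by (auto simp: card_2_iff)
  then have R: "R = {a, b1, b2, b3, c, d}" and cdn: "c \<notin> {a, b1, b2, b3}" "d \<notin> {a, b1, b2, b3}"
    and cdR: "c \<in> R" "d \<in> R"
    using a bR by blast+
  obtain q1 q2 where q12: "fib a b1 = {q1, q2}" "q1 \<noteq> q2" using b12 by (auto simp: card_2_iff)
  obtain q3 q4 where q34: "fib a b2 = {q3, q4}" "q3 \<noteq> q4" using b12 by (auto simp: card_2_iff)
  have q: "q1 \<in> B" "q2 \<in> B" "q3 \<in> B" "q4 \<in> B"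
    and qa: "m q1 a = b1" "m q2 a = b1" "m q3 a = b2" "m q4 a = b2"
    using q12 q34 unfolding fib_def by blast+
  have reach: "\<exists>p\<in>B. m p a = r" if "r \<in> {b1, b2, b3}" for r
  proof -
    have "r \<in> N a" using that Na by simp
    then show ?thesis by (auto simp: N_def)
  qed
  then obtain q5 where q5: "q5 \<in> B" "m q5 a = b3" by blast
  have swapped: "m p s = r" if "p \<in> B" "r \<in> R" "m p r = s" for p r s using invol[OF that(1,2)] that(3) by simp
  have qb: "m q1 b1 = a" "m q2 b1 = a" "m q3 b2 = a" "m q4 b2 = a" "m q5 b3 = a"
    using swapped[OF q(1) a] swapped[OF q(2) a] swapped[OF q(3) a] swapped[OF q(4) a] swapped[OF q5(1) a] qa q5(2) by blast+
  have differ: "m p r \<noteq> m p' r" if "p \<in> B" "p' \<in> B" "p \<noteq> p'" "m p a = m p' a" "r \<in> R" "r \<noteq> a" "r \<noteq> m p a"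
    for p p' r using agree[OF that(1-3) a that(5) that(4)] that(6,7) by blast
  \<comment> \<open>otherwise \<open>b3\<close> has the partners \<open>a\<close>, \<open>b2\<close>
    and a single further one, which both \<open>q3\<close> and \<open>q4\<close> would have to
    choose\<close>
  have not_b23: "m p b2 \<noteq> b3" if p: "p \<in> B" "p' \<in> B" "p \<noteq> p'" "m p a = b1" "m p' a = b1" for p p'
  proof
    assume p23: "m p b2 = b3"
    then have p32: "m p b3 = b2" using swapped p(1) bR by blast
    define e where "e = m p' b3"
    have "e \<noteq> b2" using differ[OF p(1-3), of b3] p bR ba b3 p32 by (simp add: e_def)
    moreover have "e \<noteq> a" using swapped[OF p(2) bR(3)] p(5) b3 unfolding e_def by metis
    ultimately have "card {a, b2, e} = 3" using ba by simp
    moreover have "{a, b2, e} \<subseteq> N b3" using NI[OF q5(1), of b3] NI[OF p(1), of b3] NI[OF p(2), of b3] qb p32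
      by (simp add: e_def)
    ultimately have N3: "N b3 = {a, b2, e}" using N_eq[OF bR(3)] by blast
    have "m q3 b3 \<noteq> a" "m q4 b3 \<noteq> a"
      using swapped[OF q(3) bR(3)] swapped[OF q(4) bR(3)] qa b3 by metis+
    moreover have "m q3 b3 \<noteq> b2" "m q4 b3 \<noteq> b2"
      using swapped[OF q(3) bR(3)] swapped[OF q(4) bR(3)] qb ba by metis+
    moreover have "m q3 b3 \<in> {a, b2, e}" "m q4 b3 \<in> {a, b2, e}" using NI[of _ b3] q N3 by blast+
    ultimately have "m q3 b3 = e" "m q4 b3 = e" by simp_all
    then have "m q3 b3 = m q4 b3" by simp
    then show False using differ[OF q(3,4) q34(2), of b3] qa bR ba b3 by simp
  qed
  have n23: "m q1 b2 \<noteq> b3" "m q2 b2 \<noteq> b3" using not_b23 q q12(2) qa by metis+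
  \<comment> \<open>two blue points that agree on \<open>a\<close> must differ on \<open>r\<close>,
    so they attain both \<open>c\<close> and \<open>d\<close>\<close>
  have step: "N r = {a, c, d}" if r: "r \<in> {b1, b2, b3}" and p: "p \<in> B" "p' \<in> B" "p \<noteq> p'" "m p a = m p' a"
      "m p a \<noteq> r" "m p r \<in> {c, d}" "m p' r \<in> {c, d}" for r p p'
  proof -
    have rR: "r \<in> R" "r \<noteq> a" using r bR ba by blast+
    have "m p r \<noteq> m p' r" using differ[OF p(1-4) rR] p(5) by metis
    then have "c \<in> {m p r, m p' r}" "d \<in> {m p r, m p' r}" using p(6,7) by auto
    then have "c \<in> N r" "d \<in> N r" using NI[OF p(1), of r] NI[OF p(2), of r] by auto
    moreover have "a \<in> N r"
    proof -
      obtain p0 where "p0 \<in> B" "m p0 a = r" using reach[OF r] by blast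
      then show ?thesis using swapped[of p0 a r] a NI[of p0 r] by simp
    qed
    moreover have "card {a, c, d} = 3" using cdn cd by auto
    ultimately show ?thesis using N_eq[OF rR(1), of "{a, c, d}"] by blast
  qed
  have inR: "m p r \<in> {a, b1, b2, b3, c, d}" if "p \<in> B" "r \<in> R" for p r
    using mR[OF that] unfolding R .
  have q_b2: "m p b2 \<in> {c, d}" and q_b3: "m p b3 \<in> {c, d}"
    if p: "p \<in> B" "m p a = b1" "m p b2 \<noteq> b3" for p
  proof -
    have pb1: "m p b1 = a" using swapped[OF p(1) a p(2)] .
    have "m p b2 \<noteq> a" "m p b2 \<noteq> b1" "m p b2 \<noteq> b2" "m p b3 \<noteq> a" "m p b3 \<noteq> b1" "m p b3 \<noteq> b2" "m p b3 \<noteq> b3"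
      using swapped[OF p(1) bR(2)] swapped[OF p(1) bR(3)] pb1 p(2,3) b3 b12(3) ba m(1)[OF p(1)] bR by metis+
    then show "m p b2 \<in> {c, d}" "m p b3 \<in> {c, d}" using inR[OF p(1) bR(2)] inR[OF p(1) bR(3)] p(3) by simp_all
  qed
  have N2: "N b2 = {a, c, d}"
    by (rule step[of b2 q1 q2]) (use q q12(2) qa b12(3) q_b2 n23 in auto)
  have N3: "N b3 = {a, c, d}"
    by (rule step[of b3 q1 q2]) (use q q12(2) qa b3 q_b3 n23 in auto)
  have q_b1: "m p b1 \<in> {c, d}" if p: "p \<in> B" "m p a = b2" for p
  proof -
    have pb2: "m p b2 = a" using swapped[OF p(1) a p(2)] .
    have "m p b1 \<noteq> a" "m p b1 \<noteq> b1" "m p b1 \<noteq> b2"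
      using swapped[OF p(1) bR(1)] pb2 p(2) b12(3) ba m(1)[OF p(1)] bR by metis+
    moreover have "m p b1 \<noteq> b3"
    proof
      assume "m p b1 = b3"
      then have "m p b3 = b1" using swapped[OF p(1) bR(1)] by blast
      then have "b1 \<in> {a, c, d}" using NI[OF p(1), of b3] N3 by simp
      then show False using ba cdn by blast
    qed
    ultimately show ?thesis using inR[OF p(1) bR(1)] by simp
  qed
  have N1: "N b1 = {a, c, d}"
    by (rule step[of b1 q3 q4]) (use q q34(2) qa b12(3) q_b1 in auto)
  have perm: "{m p a, m p c, m p d} = {b1, b2, b3}" if p: "p \<in> B" for p
  proof -
    have inj: "inj_on (m p) R" by (rule inj_on_inverseI[of _ "m p"]) (rule invol[OF p])
    have "m p ` {b1, b2, b3} \<subseteq> {a, c, d}" using NI[OF p, of b1] NI[OF p, of b2] NI[OF p, of b3] N1 N2 N3 by blast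
    moreover have "card (m p ` {b1, b2, b3}) = 3"
    proof -
      have "inj_on (m p) {b1, b2, b3}" using inj by (rule inj_on_subset) (use bR in blast)
      then have "card (m p ` {b1, b2, b3}) = card {b1, b2, b3}" by (rule card_image)
      then show ?thesis using b3 b12(3) by simp
    qed
    moreover have "card {a, c, d} \<le> 3" using cdn cd by auto
    ultimately have "m p ` {b1, b2, b3} = {a, c, d}" by (intro card_seteq) auto
    then have "m p ` {a, c, d} = m p ` m p ` {b1, b2, b3}" by simp
    also have "\<dots> = {b1, b2, b3}" using invol[OF p] bR by (simp add: image_image)
    finally show ?thesis by simp
  qed
  have red3: "area x y z \<noteq> 0" if "x \<in> R" "y \<in> R" "z \<in> R" "x \<noteq> y" "y \<noteq> z" "x \<noteq> z" for x y z
  proof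
    assume "area x y z = 0"
    then have "{x, y, z} \<subseteq> affine hull {x, y} \<inter> R"
      using area_zero_iff[OF that(4), of z] that by (auto intro: hull_inc)
    then have "card {x, y, z} \<le> card (affine hull {x, y} \<inter> R)" using finR by (intro card_mono) auto
    then show False using general[OF H(1)[OF that(4)]] that by simp
  qed
  have blue3: "area x y z \<noteq> 0" if "x \<in> {a, c, d}" "y \<in> {a, c, d}" "x \<noteq> y" "z \<in> B" for x y z
  proof
    assume "area x y z = 0"
    have xy: "x \<in> R" "y \<in> R" using that a cdR by blast+
    have z: "z \<in> affine hull {x, y}" using \<open>area x y z = 0\<close> area_zero_iff[OF that(3)] by simp
    have "affine hull {x, y} = affine hull {z, x}"
      using ne[OF that(4) xy(1)] z H[OF that(3)] by (intro line_eq_hull) auto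
    then have "y \<in> affine hull {z, x}" using H[OF that(3)] by simp
    then have "m z x = y" using m_unique[OF that(4) xy] that(3) by blast
    then have "y \<in> {b1, b2, b3}" using perm[OF that(4)] that(1) by blast
    then show False using that(2) ba cdn by blast
  qed
  show False
  proof (rule five_perspectivities[of a c d b1 b2 b3 B m])
    show "area a c d \<noteq> 0" by (rule red3) (use a cdR cdn cd in auto)
    show "b1 \<noteq> b2" "b1 \<noteq> b3" "b2 \<noteq> b3" using b12(3) b3 by auto
    show "area c d x \<noteq> 0 \<and> area d a x \<noteq> 0 \<and> area a c x \<noteq> 0" if "x \<in> {b1, b2, b3} \<union> B" for x
    proof (cases "x \<in> B")
      case True
      show ?thesis by (intro conjI blue3 True) (use cdn cd in auto)
    next
      case False
      then have "x \<in> R" "x \<notin> {a, c, d}" using that bR ba cdn by blast+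
      then show ?thesis using a cdR cdn cd by (intro conjI red3) auto
    qed
    show "{m q a, m q c, m q d} = {b1, b2, b3}" if "q \<in> B" for q by (rule perm[OF that])
    show "area x q (m q x) = 0" if "q \<in> B" "x \<in> {a, c, d}" for q x
    proof -
      have x: "x \<in> R" using that a cdR by blast
      show ?thesis using mH[OF that(1) x] area_zero_iff[OF ne[OF that(1) x, symmetric]] by (simp add: insert_commute)
    qed
    show "inj_on (\<lambda>q. (m q a, m q c, m q d)) B"
    proof (rule inj_onI, rule ccontr)
      fix p p' assume p: "p \<in> B" "p' \<in> B" "(m p a, m p c, m p d) = (m p' a, m p' c, m p' d)" "p \<noteq> p'"
      then have "m p a = m p' a" "m p c = m p' c" by simp_all
      then have "c = a \<or> c = m p a" using agree[OF p(1,2,4) a cdR(1)] by blast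
      moreover have "m p a \<in> {b1, b2, b3}" using perm[OF p(1)] by blast
      ultimately show False using cdn by blast
    qed
    show "card B = 5" by (rule cardB)
  qed
qed

section \<open>A tight colouring has no rich line\<close>

lemma int_le_square: "x \<le> x^2" for x :: int
proof -
  have "x * (x - 1) \<ge> 0" by (cases "x \<le> 0") (auto simp: zero_le_mult_iff)
  then show ?thesis by (simp add: power2_eq_square algebra_simps)
qed

text \<open>
  The properties of a smallest counterexample, whose contradiction is the aim of the rest of the
  proof; red is the more frequent colour.
\<close>

locale tight_colouring =
  fixes R B :: "(real^2) set"
  assumes finR: "finite R" and finB: "finite B" and disj: "R \<inter> B = {}"
    and noncollinear: "\<not> collinear (R \<union> B)"
    and blue_le: "card B \<le> card R" and red_le: "card R \<le> card B + 1"
    and tight: "card (joins R B) + 2 = card R + card B"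
    and two_red: "\<And>L. L \<in> joins R B \<Longrightarrow> 2 \<le> card (L \<inter> R)"
    and two_blue: "\<And>L. card R = card B \<Longrightarrow> L \<in> joins R B \<Longrightarrow> 2 \<le> card (L \<inter> B)"
    and three_off: "\<And>L. is_line L \<Longrightarrow> 3 \<le> card ((R \<union> B) - L)"
begin

abbreviation "J \<equiv> joins R B"
definition n :: int where "n = int (card R)"
definition b :: int where "b = int (card B)"
definition i :: "(real^2) set \<Rightarrow> int" where "i L = int (card (L \<inter> R))"
definition j :: "(real^2) set \<Rightarrow> int" where "j L = int (card (L \<inter> B))"
text \<open>
  The defect is chosen such that a line with \<open>i \<ge> 2\<close> has defect \<open>0\<close> only if it carries
  two red and one or two blue points.
\<close>

definition defect :: "(real^2) set \<Rightarrow> int" where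
  "defect L = i L + j L + (i L - j L)^2 - 4"

lemma finJ: "finite J"
  by (rule finite_joins[OF finR finB disj])

lemma card_J: "int (card J) = n + b - 2"
  using tight by (simp add: n_def b_def)

lemma balance: "b = n \<or> b = n - 1"
  using blue_le red_le by (auto simp: n_def b_def)

lemma i_ge2: "L \<in> J \<Longrightarrow> i L \<ge> 2"
  using two_red by (simp add: i_def)

lemma j_ge1: "L \<in> J \<Longrightarrow> j L \<ge> 1"
  using finB by (auto simp: j_def joins_def card_gt_0_iff Suc_le_eq Int_commute)

lemma sum_ij: "(\<Sum>L\<in>J. i L * j L) = n * b"
  using arg_cong[OF sum_joins[OF finR finB disj], of int] by (simp add: i_def j_def n_def b_def)

lemma defect_ge: "L \<in> J \<Longrightarrow> defect L \<ge> 2 * i L - 4" "L \<in> J \<Longrightarrow> defect L \<ge> 2 * j L - 4"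
  "L \<in> J \<Longrightarrow> defect L \<ge> 0"
proof -
  have *: "i L - j L \<le> (i L - j L)^2" "j L - i L \<le> (i L - j L)^2"
    using int_le_square[of "i L - j L"] int_le_square[of "j L - i L"] by (simp_all add: power2_commute)
  show 1: "L \<in> J \<Longrightarrow> defect L \<ge> 2 * i L - 4" "L \<in> J \<Longrightarrow> defect L \<ge> 2 * j L - 4"
    using * unfolding defect_def by linarith+
  show "L \<in> J \<Longrightarrow> defect L \<ge> 0" using 1 i_ge2[of L] by linarith
qed

text \<open>
  Write \<open>k = i + j\<close>.  Melchior's inequality bounds the sum of \<open>k - 3\<close> over all spanned lines, and
  counting ordered pairs gives the sums of \<open>k\<^sup>2 - k\<close> and of \<open>i * j\<close>, hence that of \<open>(i - j)\<^sup>2 - k\<close>.  Twice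
  the first sum plus the last one is the sum of \<open>k + (i - j)\<^sup>2 - 6\<close>, which is the defect minus \<open>2\<close> on a
  bichromatic line and \<open>k\<^sup>2 + k - 6\<close> on a monochromatic one.
\<close>

lemma sum_defect_all:
  "(\<Sum>L\<in>J. defect L) + (\<Sum>L\<in>spanned (R \<union> B) - J. int (card (L \<inter> (R \<union> B)))^2 + int (card (L \<inter> (R \<union> B))) - 6)
    \<le> n + b - 10 + (n - b)^2"
proof -
  let ?P = "R \<union> B" and ?S = "spanned (R \<union> B)"
  define k where "k = (\<lambda>L. int (card (L \<inter> ?P)))"
  have finP: "finite ?P" using finR finB by simp
  note finS = finite_spanned[OF finP]
  have k: "k L = i L + j L" for L
  proof -
    have "L \<inter> ?P = (L \<inter> R) \<union> (L \<inter> B)" by blast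
    moreover have "(L \<inter> R) \<inter> (L \<inter> B) = {}" using disj by blast
    ultimately show ?thesis using finR finB by (simp add: k_def i_def j_def card_Un_disjoint)
  qed
  have JS: "J \<subseteq> ?S"
  proof
    fix L assume "L \<in> J"
    then obtain x y where "is_line L" "x \<in> R" "x \<in> L" "y \<in> B" "y \<in> L" by (auto simp: joins_def)
    then show "L \<in> ?S" using disj by (intro spannedI[of L x _ y]) auto
  qed
  have k2: "k L \<ge> 2" if "L \<in> ?S" for L using spanned_card2[OF finP that] by (simp add: k_def)
  have mono: "i L = 0 \<or> j L = 0" if "L \<in> ?S - J" for L
    using that by (auto simp: joins_def spanned_def i_def j_def Int_commute)
  have cardP: "int (card ?P) = n + b" using finR finB disj by (simp add: n_def b_def card_Un_disjoint)
  have "(\<Sum>L\<in>?S. k L - 1) + 3 \<le> 2 * int (card ?S)"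
  proof -
    have "int (card (L \<inter> ?P) - 1) = k L - 1" if "L \<in> ?S" for L
      using k2[OF that] by (simp add: k_def of_nat_diff)
    then have "(\<Sum>L\<in>?S. k L - 1) = int (\<Sum>L\<in>?S. card (L \<inter> ?P) - 1)" by simp
    then show ?thesis using melchior[OF finP noncollinear] by linarith
  qed
  then have M: "(\<Sum>L\<in>?S. k L - 3) \<le> -3"
    by (simp add: sum_subtractf)
  have "int (card (L \<inter> ?P) * (card (L \<inter> ?P) - 1)) = k L ^ 2 - k L" if "L \<in> ?S" for L
    using k2[OF that] by (simp add: k_def of_nat_diff power2_eq_square algebra_simps)
  then have "(\<Sum>L\<in>?S. k L ^ 2 - k L) = int (\<Sum>L\<in>?S. card (L \<inter> ?P) * (card (L \<inter> ?P) - 1))"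
    by (simp del: of_nat_mult)
  also have "\<dots> = int (card ?P * (card ?P - 1))" using sum_spanned[OF finP] by simp
  also have "\<dots> = (n + b)^2 - (n + b)"
    unfolding cardP[symmetric]
    by (cases "card ?P") (simp_all add: power2_eq_square algebra_simps)
  finally have pairs: "(\<Sum>L\<in>?S. k L ^ 2 - k L) = (n + b)^2 - (n + b)" .
  have "(\<Sum>L\<in>?S. i L * j L) = (\<Sum>L\<in>J. i L * j L)"
    using mono finS JS by (intro sum.mono_neutral_right) auto
  then have ij: "(\<Sum>L\<in>?S. i L * j L) = n * b" using sum_ij by simp
  have "(\<Sum>L\<in>?S. k L + (i L - j L)^2 - 6)
      = (\<Sum>L\<in>?S. 2 * (k L - 3) + (k L ^ 2 - k L) - 4 * (i L * j L))"
    by (rule sum.cong) (simp_all add: k power2_eq_square algebra_simps)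
  also have "\<dots> = 2 * (\<Sum>L\<in>?S. k L - 3) + (\<Sum>L\<in>?S. k L ^ 2 - k L) - 4 * (\<Sum>L\<in>?S. i L * j L)"
    by (simp only: sum_subtractf[where f="\<lambda>L. 2 * (k L - 3) + (k L ^ 2 - k L)"]
        sum.distrib[where g="\<lambda>L. 2 * (k L - 3)"] sum_distrib_left)
  also have "\<dots> \<le> - 6 + (n - b)^2 - (n + b)"
    using M unfolding pairs ij by (simp add: power2_eq_square algebra_simps)
  finally have all: "(\<Sum>L\<in>?S. k L + (i L - j L)^2 - 6) \<le> - 6 + (n - b)^2 - (n + b)" .
  have "(\<Sum>L\<in>?S. k L + (i L - j L)^2 - 6)
      = (\<Sum>L\<in>?S - J. k L + (i L - j L)^2 - 6) + (\<Sum>L\<in>J. k L + (i L - j L)^2 - 6)"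
    using JS finS by (rule sum.subset_diff)
  moreover have "(\<Sum>L\<in>?S - J. k L + (i L - j L)^2 - 6) = (\<Sum>L\<in>?S - J. k L ^ 2 + k L - 6)"
  proof (rule sum.cong)
    fix L assume L: "L \<in> ?S - J"
    then show "k L + (i L - j L)^2 - 6 = k L ^ 2 + k L - 6"
      using mono[OF L] k[of L] by (auto simp: power2_eq_square)
  qed simp
  moreover have "(\<Sum>L\<in>J. k L + (i L - j L)^2 - 6) = (\<Sum>L\<in>J. defect L) - 2 * int (card J)"
  proof -
    have "k L + (i L - j L)^2 - 6 = defect L - 2" for L by (simp add: defect_def k)
    then show ?thesis by (simp add: sum_subtractf)
  qed
  ultimately show ?thesis using all card_J by (simp add: k_def)
qed

lemma monochromatic_term_ge0:
  assumes "L \<in> spanned (R \<union> B)"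
  shows "0 \<le> int (card (L \<inter> (R \<union> B)))^2 + int (card (L \<inter> (R \<union> B))) - 6"
proof -
  have k: "int (card (L \<inter> (R \<union> B))) \<ge> 2"
    using spanned_card2[OF _ assms] finR finB by simp
  then have "int (card (L \<inter> (R \<union> B))) ^ 2 \<ge> 2 ^ 2" by (intro power_mono) auto
  then show ?thesis using k by simp
qed

lemma sum_defect: "(\<Sum>L\<in>J. defect L) \<le> n + b - 10 + (n - b)^2"
proof -
  have "0 \<le> (\<Sum>L\<in>spanned (R \<union> B) - J. int (card (L \<inter> (R \<union> B)))^2 + int (card (L \<inter> (R \<union> B))) - 6)"
    by (intro sum_nonneg monochromatic_term_ge0) auto
  then show ?thesis using sum_defect_all by linarith
qed

text \<open>
  A monochromatic line with \<open>k \<ge> 3\<close> points contributes \<open>k\<^sup>2 + k - 6 \<ge> 6\<close> to the bound.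
\<close>

lemma sum_defect_triple:
  assumes "is_line L" "L \<notin> J" "card (L \<inter> R) \<ge> 3"
  shows "(\<Sum>M\<in>J. defect M) + 6 \<le> n + b - 10 + (n - b)^2"
proof -
  let ?f = "\<lambda>L. int (card (L \<inter> (R \<union> B)))^2 + int (card (L \<inter> (R \<union> B))) - 6"
  have fin: "finite (L \<inter> (R \<union> B))" using finR finB by simp
  have "card (L \<inter> R) \<le> card (L \<inter> (R \<union> B))" using fin by (intro card_mono) auto
  then have k: "card (L \<inter> (R \<union> B)) \<ge> 3" using assms(3) by simp
  then have "\<not> card (L \<inter> (R \<union> B)) \<le> Suc 0" by simp
  then obtain x y where "x \<in> L \<inter> (R \<union> B)" "y \<in> L \<inter> (R \<union> B)" "x \<noteq> y"
    using card_le_Suc0_iff_eq[OF fin] by blast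
  then have L: "L \<in> spanned (R \<union> B) - J" using assms by (auto intro: spannedI)
  have "int (card (L \<inter> (R \<union> B))) ^ 2 \<ge> 3 ^ 2" using k by (intro power_mono) auto
  then have "6 \<le> ?f L" using k by simp
  also have "?f L \<le> (\<Sum>L\<in>spanned (R \<union> B) - J. ?f L)"
    using L finite_spanned[of "R \<union> B"] finR finB monochromatic_term_ge0
    by (intro member_le_sum) auto
  finally show ?thesis using sum_defect_all by linarith
qed

text \<open>
  The \<open>b - j L\<close> blue points off \<open>L\<close> are distributed over the lines that join them to a given red
  point of \<open>L\<close>, and such a line \<open>M\<close> carries at most \<open>2 + defect M / 2\<close> blue points by \<open>defect_ge\<close>.  The same
  holds with the colours exchanged, and all these lines are different from each other and from \<open>L\<close>.
\<close>

lemma line_load: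
  assumes "L \<in> J"
  shows "2 * (i L * (b - j L) + j L * (n - i L)) \<le> 4 * (n + b - 3) + (\<Sum>M\<in>J. defect M) - defect L"
proof -
  let ?J1 = "joins (R \<inter> L) (B - L)" and ?J2 = "joins (B \<inter> L) (R - L)"
  note split = card_joins_split[OF finR finB disj assms]
  have L: "is_line L" using assms by (simp add: joins_def)
  have fin: "finite ?J1" "finite ?J2"
    using finite_subset[OF _ finJ] split(2) by blast+
  have off: "int (card (B - L)) = b - j L" "int (card (R - L)) = n - i L"
    using card_Int_Diff[OF finB, of L] card_Int_Diff[OF finR, of L]
    by (simp_all add: b_def n_def i_def j_def Int_commute)
  have on: "int (card (R \<inter> L)) = i L" "int (card (B \<inter> L)) = j L"
    by (simp_all add: i_def j_def Int_commute)
  have d: "(B - L) \<inter> L = {}" "(R - L) \<inter> L = {}" by blast+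
  have "2 * (i L * (b - j L)) = (\<Sum>M\<in>?J1. 2 * int (card (M \<inter> (B - L))))"
    using arg_cong[OF sum_joins_line[OF L Int_lower2[of R L] d(1)], of int] finR finB
    by (simp add: off on sum_distrib_left[symmetric]) 
  also have "\<dots> \<le> (\<Sum>M\<in>?J1. 4 + defect M)"
  proof (rule sum_mono)
    fix M assume M: "M \<in> ?J1"
    have "card (M \<inter> (B - L)) \<le> card (M \<inter> B)" using finB by (intro card_mono) auto
    moreover have "M \<in> J" using M split(2) by blast
    ultimately show "2 * int (card (M \<inter> (B - L))) \<le> 4 + defect M"
      using defect_ge(2)[of M] by (simp add: j_def)
  qed
  finally have 1: "2 * (i L * (b - j L)) \<le> (\<Sum>M\<in>?J1. 4 + defect M)" .
  have "2 * (j L * (n - i L)) = (\<Sum>M\<in>?J2. 2 * int (card (M \<inter> (R - L))))"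
    using arg_cong[OF sum_joins_line[OF L Int_lower2[of B L] d(2)], of int] finR finB
    by (simp add: off on sum_distrib_left[symmetric]) 
  also have "\<dots> \<le> (\<Sum>M\<in>?J2. 4 + defect M)"
  proof (rule sum_mono)
    fix M assume M: "M \<in> ?J2"
    have "card (M \<inter> (R - L)) \<le> card (M \<inter> R)" using finR by (intro card_mono) auto
    moreover have "M \<in> J" using M split(2) by blast
    ultimately show "2 * int (card (M \<inter> (R - L))) \<le> 4 + defect M"
      using defect_ge(1)[of M] by (simp add: i_def)
  qed
  finally have 2: "2 * (j L * (n - i L)) \<le> (\<Sum>M\<in>?J2. 4 + defect M)" .
  have "(\<Sum>M\<in>?J1. 4 + defect M) + (\<Sum>M\<in>?J2. 4 + defect M) = (\<Sum>M\<in>?J1 \<union> ?J2. 4 + defect M)"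
    using fin split(3) by (simp add: sum.union_disjoint)
  also have "\<dots> \<le> (\<Sum>M\<in>J - {L}. 4 + defect M)"
    using finJ split(2) defect_ge(3) by (intro sum_mono2) fastforce+
  also have "\<dots> = (\<Sum>M\<in>J. 4 + defect M) - (4 + defect L)"
    using finJ assms by (subst sum_diff1) auto
  also have "\<dots> = 4 * (n + b - 3) + (\<Sum>M\<in>J. defect M) - defect L"
    using card_J by (simp add: sum.distrib)
  finally show ?thesis using 1 2 by (simp add: distrib_left)
qed

lemma line_bound:
  assumes "L \<in> J" "int c \<le> b - j L" "int a \<le> n - i L"
  shows "i L * int c + j L * int a + 3 \<le> n + b + int (c choose 2) + int (a choose 2)"
proof -
  have off: "int (card (B - L)) = b - j L" "int (card (R - L)) = n - i L"
    using card_Int_Diff[OF finB, of L] card_Int_Diff[OF finR, of L]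
    by (simp_all add: b_def n_def i_def j_def Int_commute)
  have "1 + card (R \<inter> L) * c + card (B \<inter> L) * a \<le> card J + (c choose 2) + (a choose 2)"
    by (rule joins_line_bound[OF finR finB disj assms(1)]) (use off assms in linarith)+
  then have "int (1 + card (R \<inter> L) * c + card (B \<inter> L) * a) \<le> int (card J + (c choose 2) + (a choose 2))"
    by (simp only: of_nat_le_iff)
  then show ?thesis using card_J by (simp add: i_def j_def Int_commute)
qed

lemma off_ge3: "L \<in> J \<Longrightarrow> (n - i L) + (b - j L) \<ge> 3"
proof -
  assume "L \<in> J"
  then have "3 \<le> card ((R \<union> B) - L)" by (intro three_off) (simp add: joins_def)
  moreover have "card ((R \<union> B) - L) = card (R - L) + card (B - L)"
    unfolding Un_Diff using finR finB disj by (intro card_Un_disjoint) auto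
  moreover have "int (card (B - L)) = b - j L" "int (card (R - L)) = n - i L"
    using card_Int_Diff[OF finB, of L] card_Int_Diff[OF finR, of L]
    by (simp_all add: b_def n_def i_def j_def Int_commute)
  ultimately show ?thesis by linarith
qed

lemma on_le: "i L \<le> n" "j L \<le> b"
  using finR finB by (auto simp: i_def j_def n_def b_def intro!: card_mono)

text \<open>
  Joining the points of \<open>L\<close> to two points of each colour off \<open>L\<close> shows that \<open>L\<close> has fewer than \<open>n\<close>
  points (with small variations if at most one point of some colour lies off \<open>L\<close>).  For such
  moderately rich lines \<open>line_load\<close> contradicts the bound on the total defect.
\<close>

lemma no_rich_line:
  assumes "L \<in> J"
  shows "i L \<le> 2 \<or> j L \<le> 2"
proof (rule ccontr)
  assume "\<not> ?thesis"
  then have ij: "i L \<ge> 3" "j L \<ge> 3" by auto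
  note lb = line_bound[OF assms]
  have b2: "b - j L \<ge> 2"
  proof (rule ccontr)
    assume "\<not> b - j L \<ge> 2"
    then consider "b - j L = 0" | "b - j L = 1" using on_le[of L] by linarith
    then show False
    proof cases
      case 1 then show ?thesis using lb[of 0 2] off_ge3[OF assms] balance ij by (simp add: binomial_eq_0)
    next
      case 2 then show ?thesis using lb[of 1 2] off_ge3[OF assms] balance ij by (simp add: binomial_eq_0)
    qed
  qed
  have a2: "n - i L \<ge> 2"
  proof (rule ccontr)
    assume "\<not> n - i L \<ge> 2"
    then consider "n - i L = 0" | "n - i L = 1" using on_le[of L] by linarith
    then show False
    proof cases
      case 1 then show ?thesis using lb[of 2 0] off_ge3[OF assms] balance ij by (simp add: binomial_eq_0)
    next
      case 2 then show ?thesis using lb[of 2 1] off_ge3[OF assms] balance ij by (simp add: binomial_eq_0)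
    qed
  qed
  define s where "s = i L + j L"
  define d where "d = i L - j L"
  have "2 * s \<le> n + b - 1" using lb[of 2 2] a2 b2 by (simp add: s_def)
  then have sn: "s + 1 \<le> n" using balance by linarith
  have s6: "s \<ge> 6" using ij by (simp add: s_def)
  \<comment> \<open>the inequalities below are linear in \<open>n\<close> with slope \<open>2 * (s -
    5) > 0\<close>, so it suffices to treat the smallest value \<open>n = s + 1\<close>\<close>
  have prod: "2 * (s - 5) * n \<ge> 2 * (s - 5) * (s + 1)" using sn s6 by (intro mult_left_mono) auto
  have dd: "4 * (i L * j L) = s^2 - d^2" by (simp add: s_def d_def power2_eq_square algebra_simps)
  have load: "2 * (i L * (b - j L) + j L * (n - i L)) \<le> 5 * (n + b) - 22 + (n - b)^2 - (s + d^2 - 4)"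
    using line_load[OF assms] sum_defect by (simp add: defect_def s_def d_def)
  from balance show False
  proof
    assume b: "b = n"
    have "2 * (i L * (b - j L) + j L * (n - i L)) = 2 * s * n - 4 * (i L * j L)"
      by (simp add: b s_def algebra_simps)
    then have "2 * s * n - (s^2 - d^2) \<le> 10 * n - 22 - (s + d^2 - 4)" using load dd by (simp add: b)
    then have "2 * (s - 5) * n - s^2 + s + 18 + 2 * d^2 \<le> 0" by (simp add: algebra_simps)
    moreover have "d^2 \<ge> 0" by simp
    ultimately have "2 * (s - 5) * n - s^2 + s + 18 \<le> 0" by linarith
    then have "2 * (s - 5) * (s + 1) - s^2 + s + 18 \<le> 0" using prod by linarith
    then have "(s - 6) * (s - 1) + 2 \<le> 0" by (simp add: power2_eq_square algebra_simps)
    moreover have "(s - 6) * (s - 1) \<ge> 0" using s6 by simp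
    ultimately show False by linarith
  next
    assume b: "b = n - 1"
    have "2 * (i L * (b - j L) + j L * (n - i L)) = 2 * s * n - 4 * (i L * j L) - s - d"
      by (simp add: b s_def d_def algebra_simps)
    then have "2 * s * n - (s^2 - d^2) - s - d \<le> 10 * n - 26 - (s + d^2 - 4)"
      using load dd by (simp add: b)
    moreover have "2 * d^2 - d \<ge> 0"
    proof -
      have "d * (2 * d - 1) \<ge> 0" by (cases "d \<le> 0") (auto simp: zero_le_mult_iff)
      then show ?thesis by (simp add: power2_eq_square algebra_simps)
    qed
    ultimately have main: "2 * (s - 5) * n - s^2 + 22 \<le> 0" by (simp add: algebra_simps)
    consider "s = 6" | "s = 7" | "s \<ge> 8" using s6 by linarith
    then show False
    proof cases
      case 1
      \<comment> \<open>here \<open>line_load\<close> is not strong enough, but three points of each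
        colour off \<open>L\<close> are\<close>
      then have "n = 7" using main sn by simp
      moreover have "i L = 3" "j L = 3" using 1 ij by (auto simp: s_def)
      ultimately show ?thesis using lb[of 3 3] b by (simp add: numeral_eq_Suc)
    next
      case 2
      then show ?thesis using main sn by simp
    next
      case 3
      have "2 * (s - 5) * (s + 1) - s^2 + 22 \<le> 0" using main prod by linarith
      then have "(s - 2) * (s - 6) \<le> 0" by (simp add: power2_eq_square algebra_simps)
      moreover have "(s - 2) * (s - 6) > 0" using 3 by simp
      ultimately show ?thesis by linarith
    qed
  qed
qed

text \<open>
  If \<open>i\<close> or \<open>j\<close> is \<open>2\<close>, then with \<open>x\<close> the other number minus \<open>2\<close> the claim reads \<open>x \<le> x\<^sup>2\<close>.
\<close>

lemma ij_le_defect: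
  assumes "L \<in> J"
  shows "i L * j L \<le> defect L + 4"
proof -
  from no_rich_line[OF assms] i_ge2[OF assms] j_ge1[OF assms]
  consider "i L = 2" | "j L = 1" | "j L = 2" by linarith
  then show ?thesis
  proof cases
    case 1 then show ?thesis using int_le_square[of "j L - 2"] by (simp add: defect_def power2_eq_square algebra_simps)
  next
    case 2 then show ?thesis by (simp add: defect_def)
  next
    case 3 then show ?thesis using int_le_square[of "i L - 2"] by (simp add: defect_def power2_eq_square algebra_simps)
  qed
qed

lemma product_bound: "n * b \<le> (\<Sum>L\<in>J. defect L) + 4 * (n + b - 2)"
proof -
  have "(\<Sum>L\<in>J. i L * j L) \<le> (\<Sum>L\<in>J. defect L + 4)"
    by (intro sum_mono ij_le_defect)
  then show ?thesis using sum_ij card_J by (simp add: sum.distrib)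
qed

end

section \<open>The remaining small colourings\<close>

lemma card_joins_ge_points:
  assumes "is_line L" "X \<subseteq> L" "Y \<inter> L = {}" "finite X" "finite Y"
    and k: "\<And>x. x \<in> X \<Longrightarrow> k \<le> card (joins {x} Y)"
  shows "card X * k \<le> card (joins X Y)"
proof -
  have disj: "{x} \<inter> Y = {}" if "x \<in> X" for x using assms(2,3) that by blast
  have "card X * k \<le> (\<Sum>x\<in>X. card (joins {x} Y))" using sum_mono[of X "\<lambda>_. k", OF k] by simp
  also have "\<dots> = card (\<Union>x\<in>X. joins {x} Y)"
  proof (rule card_UN_disjoint[symmetric, OF assms(4)])
    show "\<forall>x\<in>X. finite (joins {x} Y)" using finite_joins[of "{_}" Y] disj assms(5) by simp
    show "\<forall>x\<in>X. \<forall>y\<in>X. x \<noteq> y \<longrightarrow> joins {x} Y \<inter> joins {y} Y = {}"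
    proof (intro ballI impI, rule ccontr)
      fix x y assume xy: "x \<in> X" "y \<in> X" "x \<noteq> y" "joins {x} Y \<inter> joins {y} Y \<noteq> {}"
      then obtain M z where "is_line M" "x \<in> M" "y \<in> M" "z \<in> Y" "z \<in> M" by (auto simp: joins_def)
      moreover from this have "M = L" using line_unique[of M L x y] xy assms(1,2) by blast
      ultimately show False using assms(3) by blast
    qed
  qed
  also have "(\<Union>x\<in>X. joins {x} Y) = joins X Y" by (auto simp: joins_def)
  finally show ?thesis .
qed

text \<open>
  Lines with at most \<open>m\<close> points of \<open>Y\<close> each that have \<open>t\<close> incidences with \<open>Y\<close> number at least \<open>t / m\<close>.
\<close>

lemma card_joins_ge_div:
  assumes "finite X" "finite Y" "X \<inter> Y = {}" "\<And>M. M \<in> joins X Y \<Longrightarrow> card (M \<inter> Y) \<le> m"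
    and "(\<Sum>M\<in>joins X Y. card (M \<inter> Y)) = t"
  shows "t \<le> m * card (joins X Y)"
  using sum_mono[of "joins X Y" "\<lambda>M. card (M \<inter> Y)" "\<lambda>_. m"] assms(4,5) by (simp add: mult.commute)

text \<open>
  The lines joining a point \<open>y\<close> to \<open>X\<close> partition \<open>X\<close>; if \<open>X\<close> has odd size then one of them contains
  an odd number of points of \<open>X\<close>.  So these odd lines cover \<open>Y\<close>.
\<close>

lemma odd_cover:
  assumes "finite X" "finite Y" "X \<inter> Y = {}" "odd (card X)"
  shows "card Y \<le> (\<Sum>M\<in>{M \<in> joins X Y. odd (card (M \<inter> X))}. card (M \<inter> Y))"
proof -
  let ?O = "{M \<in> joins X Y. odd (card (M \<inter> X))}"
  have fin: "finite (joins X Y)" by (rule finite_joins[OF assms(1-3)])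
  have "Y \<subseteq> (\<Union>M\<in>?O. M \<inter> Y)"
  proof
    fix y assume y: "y \<in> Y"
    then have "(\<Sum>M\<in>joins {y} X. card (M \<inter> X)) = card X"
      using assms by (intro sum_joins_point) auto
    then have "\<not> even (\<Sum>M\<in>joins {y} X. card (M \<inter> X))" using assms(4) by simp
    then obtain M where "M \<in> joins {y} X" "odd (card (M \<inter> X))" using dvd_sum by metis
    then show "y \<in> (\<Union>M\<in>?O. M \<inter> Y)" using y by (auto simp: joins_def)
  qed
  then have "card Y \<le> card (\<Union>M\<in>?O. M \<inter> Y)"
    using fin assms(2) by (intro card_mono) auto
  also have "\<dots> \<le> (\<Sum>M\<in>?O. card (M \<inter> Y))" using fin by (intro card_UN_le) auto
  finally show ?thesis .
qed

context tight_colouring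
begin

text \<open>
  If \<open>b = n\<close> then every bichromatic line has \<open>i * j \<ge> 4\<close>, so \<open>4 * (2 * n - 2) \<le> n\<^sup>2\<close>; together with
  \<open>product_bound\<close> only \<open>n = 7\<close> remains, and there \<open>n\<^sup>2\<close> is odd whereas all products \<open>i * j\<close> are even.
\<close>

lemma b_less_n: "b = n - 1"
proof (rule ccontr)
  assume "b \<noteq> n - 1"
  then have b: "b = n" using balance by simp
  have three: "3 \<le> n + b"
  proof -
    obtain L :: "(real^2) set" where "is_line L" using line_through_exists by metis
    then have "3 \<le> card ((R \<union> B) - L)" by (rule three_off)
    also have "\<dots> \<le> card (R \<union> B)" using finR finB by (intro card_mono) auto
    finally show ?thesis using finR finB disj by (simp add: n_def b_def card_Un_disjoint)
  qed
  have j2: "j L \<ge> 2" if "L \<in> J" for L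
    using two_blue that b by (simp add: n_def b_def j_def)
  have "(\<Sum>L\<in>J. 4) \<le> (\<Sum>L\<in>J. i L * j L)"
  proof (rule sum_mono)
    fix L assume L: "L \<in> J"
    have "2 * 2 \<le> i L * j L" using i_ge2[OF L] j2[OF L] by (intro mult_mono) simp_all
    then show "4 \<le> i L * j L" by simp
  qed
  then have low: "4 * (2 * n - 2) \<le> n * n" using sum_ij card_J b by simp
  have high: "n * n \<le> 10 * n - 18" using product_bound sum_defect b by simp
  have "n \<ge> 2" using three b by simp
  have "n < 8"
  proof (rule ccontr)
    assume "\<not> n < 8"
    then have "(n - 8) * (n - 2) \<ge> 0" by simp
    then show False using high by (simp add: algebra_simps)
  qed
  have "n > 6"
  proof (rule ccontr)
    assume "\<not> n > 6"
    then have "(n - 6) * (n - 2) \<le> 0" using \<open>n \<ge> 2\<close> by (simp add: mult_le_0_iff)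
    then show False using low by (simp add: algebra_simps)
  qed
  then have "n = 7" using \<open>n < 8\<close> by simp
  moreover have "even (\<Sum>L\<in>J. i L * j L)"
  proof (rule dvd_sum)
    fix L assume L: "L \<in> J"
    then have "i L = 2 \<or> j L = 2" using no_rich_line i_ge2 j2 by (meson antisym)
    then show "even (i L * j L)" by auto
  qed
  ultimately show False using sum_ij b by simp
qed

lemma odd_cover_blue:
  assumes "odd n" shows "b \<le> (\<Sum>M\<in>{M \<in> J. odd (i M)}. j M)"
proof -
  have "odd (card R)" using assms by (simp add: n_def)
  from odd_cover[OF finR finB disj this] show ?thesis
    unfolding b_def i_def j_def by (simp flip: of_nat_sum)
qed

lemma odd_cover_red:
  assumes "odd b" shows "n \<le> (\<Sum>M\<in>{M \<in> J. odd (j M)}. i M)"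
proof -
  have "odd (card B)" using assms by (simp add: b_def)
  moreover have "B \<inter> R = {}" using disj by blast
  ultimately show ?thesis
    using odd_cover[OF finB finR] unfolding n_def i_def j_def joins_commute[of B R]
    by (simp flip: of_nat_sum)
qed

lemma defect_total: "(\<Sum>M\<in>J. defect M) \<le> 2 * n - 10" "0 \<le> (\<Sum>M\<in>J. defect M)"
  using sum_defect b_less_n sum_nonneg[of J defect] defect_ge(3) by auto

lemma defect_le_total: "L \<in> J \<Longrightarrow> defect L \<le> (\<Sum>M\<in>J. defect M)"
  using defect_ge(3) finJ by (intro member_le_sum) auto

lemma n_range: "5 \<le> n" "n \<le> 8"
proof -
  show "5 \<le> n" using defect_total by linarith
  have "n * (n - 1) \<le> 10 * n - 22" using product_bound defect_total b_less_n by simp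
  then have "(n - 9) * (n - 2) + 4 \<le> 0" by (simp add: algebra_simps)
  then show "n \<le> 8" using mult_nonneg_nonneg[of "n - 9" "n - 2"] by linarith
qed

text \<open>
  A line with \<open>i\<close> odd has \<open>i \<ge> 3\<close>, hence \<open>j \<le> 2\<close> and \<open>defect \<ge> 2 * i - 4 \<ge> j\<close>.  So if \<open>n\<close> is odd, the
  lines with \<open>i\<close> odd, which cover all blue points, have total defect at least \<open>b\<close>.
\<close>

lemma n_even: "even n"
proof (rule ccontr)
  assume odd: "odd n"
  have "b \<le> (\<Sum>M\<in>{M \<in> J. odd (i M)}. j M)" by (rule odd_cover_blue[OF odd])
  also have "\<dots> \<le> (\<Sum>M\<in>{M \<in> J. odd (i M)}. defect M)"
  proof (rule sum_mono)
    fix M assume "M \<in> {M \<in> J. odd (i M)}"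
    then have M: "M \<in> J" "i M \<noteq> 2" by auto
    then have "i M \<ge> 3" using i_ge2[of M] by simp
    then show "j M \<le> defect M" using no_rich_line[OF M(1)] defect_ge(1)[OF M(1)] by linarith
  qed
  also have "\<dots> \<le> (\<Sum>M\<in>J. defect M)" using finJ defect_ge(3) by (intro sum_mono2) auto
  finally have "n \<le> 2 * n - 9 \<and> n - 1 \<le> 2 * n - 10" using defect_total b_less_n by simp
  then have "n \<ge> 9" by simp
  then show False using n_range by simp
qed

lemma off_line_counts:
  assumes "L \<in> J"
  shows "card (R \<inter> L) = nat (i L)" "card (B \<inter> L) = nat (j L)"
    "card (R - L) = nat (n - i L)" "card (B - L) = nat (b - j L)"
  using card_Int_Diff[OF finB, of L] card_Int_Diff[OF finR, of L]
  by (simp_all add: b_def n_def i_def j_def Int_commute)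

text \<open>
  If all bichromatic lines have two red points, then the \<open>n - 2\<close> red points off \<open>L\<close> are
  joined to each blue point of \<open>L\<close> by at least \<open>(n - 2) / 2\<close> lines.
\<close>

lemma blue_spokes:
  assumes "L \<in> J" "\<And>M. M \<in> J \<Longrightarrow> i M = 2"
  shows "nat (j L) * nat (n - 2) \<le> 2 * card (joins (B \<inter> L) (R - L))"
proof (rule card_joins_ge_div)
  have L: "is_line L" using assms by (simp add: joins_def)
  show "finite (B \<inter> L)" "finite (R - L)" "B \<inter> L \<inter> (R - L) = {}" using finR finB by auto
  show "card (M \<inter> (R - L)) \<le> 2" if "M \<in> joins (B \<inter> L) (R - L)" for M
  proof -
    have "M \<in> J" using that by (auto simp: joins_def)
    then have "card (M \<inter> R) = 2" using assms(2) by (simp add: i_def)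
    moreover have "card (M \<inter> (R - L)) \<le> card (M \<inter> R)" using finR by (intro card_mono) auto
    ultimately show ?thesis by simp
  qed
  have "(\<Sum>M\<in>joins (B \<inter> L) (R - L). card (M \<inter> (R - L))) = card (B \<inter> L) * card (R - L)"
    by (rule sum_joins_line[OF L]) (use finR finB in auto)
  then show "(\<Sum>M\<in>joins (B \<inter> L) (R - L). card (M \<inter> (R - L))) = nat (j L) * nat (n - 2)"
    using off_line_counts[OF assms(1)] assms(2)[OF assms(1)] by simp
qed

text \<open>
  For \<open>n = 8\<close> all estimates are sharp.  As \<open>b\<close> is odd, the lines with \<open>j\<close> odd cover the red points, so the
  sum of \<open>\<phi>\<close> is at least \<open>8\<close>; on the other hand \<open>\<phi>\<close> is at most \<open>2 * defect + 4 - i * j\<close>, whose sum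
  is at most \<open>8\<close>.  Equality leaves only lines with \<open>i = 2\<close> and \<open>j \<le> 3\<close>, and some line has
  \<open>j = 3\<close>.  The points of this line lie on too many other bichromatic lines.
\<close>

lemma n_not_8: "n \<noteq> 8"
proof
  assume n: "n = 8"
  then have b: "b = 7" using b_less_n by simp
  define \<phi> where "\<phi> = (\<lambda>M. if odd (j M) then i M else 0)"
  define g where "g = (\<lambda>M. 2 * defect M + 4 - i M * j M - \<phi> M)"
  have g: "0 \<le> g M \<and> (g M = 0 \<longrightarrow> i M = 2 \<and> j M \<le> 3)" if M: "M \<in> J" for M
  proof -
    from no_rich_line[OF M] i_ge2[OF M] j_ge1[OF M]
    consider "i M = 2" | "j M = 1" "i M \<ge> 3" | "j M = 2" "i M \<ge> 3" by linarith
    then show ?thesis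
    proof cases
      case 1
      define y where "y = j M - 2"
      have "g M = 2 * y^2 - \<phi> M"
        using 1 by (simp add: g_def defect_def y_def power2_eq_square algebra_simps)
      moreover have y1: "y \<ge> -1" using j_ge1[OF M] by (simp add: y_def)
      moreover have "\<phi> M = (if odd y then 2 else 0)" using 1 by (simp add: \<phi>_def y_def)
      moreover have "y^2 \<ge> 1" if "odd y"
      proof -
        have "y \<noteq> 0" using that by auto
        then show ?thesis by (simp add: int_one_le_iff_zero_less)
      qed
      moreover have "y^2 > y" if "y \<ge> 2"
        using that by (simp add: power2_eq_square)
      ultimately have "0 \<le> g M" "g M = 0 \<Longrightarrow> y \<le> 1"
        by (auto split: if_splits) (smt (verit))+
      then show ?thesis using 1 by (auto simp: y_def)
    next
      case 2
      have "g M = 2 * (i M - 1)^2 - 2"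
        using 2 by (simp add: g_def defect_def \<phi>_def power2_eq_square algebra_simps)
      moreover have "(i M - 1)^2 \<ge> i M - 1" by (rule int_le_square)
      ultimately show ?thesis using 2 by auto
    next
      case 3
      have "g M = 2 * (i M - 2)^2"
        using 3 by (simp add: g_def defect_def \<phi>_def power2_eq_square algebra_simps)
      then show ?thesis using 3 by auto
    qed
  qed
  have "(\<Sum>M\<in>J. \<phi> M) = (\<Sum>M\<in>{M \<in> J. odd (j M)}. i M)"
    unfolding \<phi>_def using finJ by (intro sum.inter_filter[symmetric])
  then have \<phi>: "8 \<le> (\<Sum>M\<in>J. \<phi> M)" using odd_cover_red n b by simp
  have sum_g: "(\<Sum>M\<in>J. g M) = 2 * (\<Sum>M\<in>J. defect M) - 4 - (\<Sum>M\<in>J. \<phi> M)"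
  proof -
    have "(\<Sum>M\<in>J. g M) = (\<Sum>M\<in>J. 2 * defect M) + (\<Sum>M\<in>J. 4) - (\<Sum>M\<in>J. i M * j M) - (\<Sum>M\<in>J. \<phi> M)"
      unfolding g_def by (simp only: sum_subtractf sum.distrib)
    then show ?thesis using sum_ij card_J n b by (simp add: sum_distrib_left)
  qed
  have D: "(\<Sum>M\<in>J. defect M) \<le> 6" using defect_total n by simp
  have "0 \<le> (\<Sum>M\<in>J. g M)" using g by (intro sum_nonneg) blast
  then have "(\<Sum>M\<in>J. g M) = 0" and D6: "(\<Sum>M\<in>J. defect M) = 6" using sum_g D \<phi> by linarith+
  then have "\<And>M. M \<in> J \<Longrightarrow> g M = 0"
    using sum_nonneg_eq_0_iff[OF finJ, of g] g by blast
  then have ij: "\<And>M. M \<in> J \<Longrightarrow> i M = 2" "\<And>M. M \<in> J \<Longrightarrow> j M \<le> 3" using g by blast+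
  obtain L where L: "L \<in> J" "defect L \<noteq> 0" using D6 by (metis sum.neutral zero_neq_numeral)
  have "j L = 3"
  proof -
    have "j L = 1 \<or> j L = 2 \<or> j L = 3" using j_ge1[OF L(1)] ij(2)[OF L(1)] by linarith
    then show ?thesis using L(2) ij(1)[OF L(1)] by (auto simp: defect_def)
  qed
  note counts = off_line_counts[OF L(1), unfolded ij(1)[OF L(1)] \<open>j L = 3\<close> n b]
  have line: "is_line L" using L by (simp add: joins_def)
  have "18 \<le> 2 * card (joins (B \<inter> L) (R - L))"
    using blue_spokes[OF L(1) ij(1)] n \<open>j L = 3\<close> by simp
  moreover have "card (R \<inter> L) * 2 \<le> card (joins (R \<inter> L) (B - L))"
  proof (rule card_joins_ge_points[OF line])
    fix x assume x: "x \<in> R \<inter> L"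
    then have xB: "x \<notin> B - L" by blast
    have "4 \<le> 3 * card (joins {x} (B - L))"
    proof (rule card_joins_ge_div)
      show "card (M \<inter> (B - L)) \<le> 3" if "M \<in> joins {x} (B - L)" for M
      proof -
        have "M \<in> J" using that x by (auto simp: joins_def)
        then have "card (M \<inter> B) \<le> 3" using ij(2) by (force simp: j_def)
        moreover have "card (M \<inter> (B - L)) \<le> card (M \<inter> B)" using finB by (intro card_mono) auto
        ultimately show ?thesis by simp
      qed
      show "(\<Sum>M\<in>joins {x} (B - L). card (M \<inter> (B - L))) = 4"
        using sum_joins_point[OF xB] finB counts by simp
    qed (use finB xB in auto)
    then show "2 \<le> card (joins {x} (B - L))" by linarith
  qed (use finR finB in auto)
  moreover have "card (joins R B) = 13" using card_J n b by simp
  ultimately show False using card_joins_split(1)[OF finR finB disj L(1)] counts by simp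
qed

text \<open>
  For \<open>n = 6\<close> the total defect is at most \<open>2\<close>.  A line with \<open>i > 2\<close> would have \<open>i = 3\<close> and be the only one of
  positive defect, but then a blue point on it would lie on lines with \<open>3, 2, 2, \<dots>\<close> red points, which cannot add
  up to \<open>6\<close>.  Hence \<open>i = 2\<close> throughout; a line with \<open>j = 3\<close> would meet too many others.  Finally no
  three red points are collinear by \<open>sum_defect_triple\<close>.
\<close>

lemma n_not_6: "n \<noteq> 6"
proof
  assume n: "n = 6"
  then have b: "b = 5" using b_less_n by simp
  have D: "(\<Sum>M\<in>J. defect M) \<le> 2" using defect_total n by simp
  have i2: "i M = 2" if M: "M \<in> J" for M
  proof (rule ccontr)
    assume "i M \<noteq> 2"
    then have i3: "i M \<ge> 3" using i_ge2[OF M] by simp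
    have d2: "defect M \<le> 2" using defect_le_total[OF M] D by simp
    then have i: "i M = 3" and defM: "defect M = 2" using defect_ge(1)[OF M] i3 by linarith+
    obtain y where y: "y \<in> B" "y \<in> M" using M by (auto simp: joins_def)
    have yR: "y \<notin> R" using y disj by blast
    have sub: "joins {y} R \<subseteq> J" using y by (auto simp: joins_def)
    have My: "M \<in> joins {y} R" using M y by (auto simp: joins_def)
    have finy: "finite (joins {y} R)" using sub finJ finite_subset by blast
    have rest: "i M' = 2" if M': "M' \<in> joins {y} R - {M}" for M'
    proof -
      have M'J: "M' \<in> J" "M' \<noteq> M" using M' sub by auto
      have "defect M + defect M' \<le> (\<Sum>M\<in>J. defect M)"
      proof -
        have "(\<Sum>M\<in>{M, M'}. defect M) \<le> (\<Sum>M\<in>J. defect M)"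
          using M M'J finJ defect_ge(3) by (intro sum_mono2) auto
        then show ?thesis using M'J by simp
      qed
      then have "defect M' \<le> 0" using D defM by simp
      then show ?thesis using defect_ge(1)[OF M'J(1)] i_ge2[OF M'J(1)] by simp
    qed
    have "n = (\<Sum>M\<in>joins {y} R. i M)"
      using sum_joins_point[OF yR finR] unfolding n_def i_def by (simp flip: of_nat_sum)
    also have "\<dots> = i M + (\<Sum>M\<in>joins {y} R - {M}. i M)" by (rule sum.remove[OF finy My])
    also have "(\<Sum>M\<in>joins {y} R - {M}. i M) = (\<Sum>M\<in>joins {y} R - {M}. 2)" using rest by simp
    finally have "6 = 3 + 2 * int (card (joins {y} R - {M}))" using n i by simp
    then show False by presburger
  qed
  have card_9: "card J = 9" using card_J n b by simp
  have j2: "j L \<le> 2" if L: "L \<in> J" for L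
  proof (rule ccontr)
    assume "\<not> j L \<le> 2"
    then have "j L = 3"
      using defect_le_total[OF L] D defect_ge(2)[OF L] by linarith
    note counts = off_line_counts[OF L, unfolded i2[OF L] \<open>j L = 3\<close> n b]
    have line: "is_line L" using L by (simp add: joins_def)
    have "12 \<le> 2 * card (joins (B \<inter> L) (R - L))"
      using blue_spokes[OF L i2] n \<open>j L = 3\<close> by simp
    moreover have "card (R \<inter> L) * card (B - L) \<le> card (joins (R \<inter> L) (B - L)) + (card (B - L) choose 2)"
      by (rule card_joins_ge[OF line]) (use finR finB in auto)
    ultimately show False
      using card_joins_split(1)[OF finR finB disj L] counts card_9 by simp
  qed
  show False
  proof (rule no_six_five_configuration[OF finR finB disj])
    show "card R = 6" "card B = 5" using n b by (simp_all add: n_def b_def)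
    show "card J = 9" by (rule card_9)
    show "card (L \<inter> R) = 2" if "L \<in> J" for L using i2[OF that] by (simp add: i_def)
    show "card (L \<inter> B) \<le> 2" if "L \<in> J" for L using j2[OF that] by (simp add: j_def)
    show "card (L \<inter> R) \<le> 2" if "is_line L" for L
    proof (rule ccontr)
      assume c: "\<not> card (L \<inter> R) \<le> 2"
      then have "L \<notin> J" using i2[of L] by (auto simp: i_def)
      then have "(\<Sum>M\<in>J. defect M) + 6 \<le> n + b - 10 + (n - b)^2"
        using c that by (intro sum_defect_triple) auto
      then show False using defect_total(2) n b by simp
    qed
  qed
qed

lemma contradiction: False
proof -
  have "n = 6 \<or> n = 8"
    using n_range n_even by presburger
  then show False using n_not_6 n_not_8 by blast
qed

end

section \<open>Induction on the number of points\<close>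

lemma not_collinear_off: "\<not> collinear P \<longleftrightarrow> (\<forall>L. is_line L \<longrightarrow> P - L \<noteq> {})"
  unfolding collinear_iff_subset_line by blast

lemma card_off_ge2_iff:
  assumes "finite P"
  shows "\<not> collinear P \<and> \<not> near_pencil P \<longleftrightarrow> (\<forall>L. is_line L \<longrightarrow> 2 \<le> card (P - L))"
proof
  assume P: "\<not> collinear P \<and> \<not> near_pencil P"
  show "\<forall>L. is_line L \<longrightarrow> 2 \<le> card (P - L)"
  proof (intro allI impI)
    fix L :: "(real^2) set" assume L: "is_line L"
    have "card (P - L) \<noteq> 0" using P L assms not_collinear_off[of P] by simp
    moreover have "card (P - L) \<noteq> 1" using P L by (auto simp: near_pencil_def)
    ultimately show "2 \<le> card (P - L)" by linarith
  qed
next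
  assume off: "\<forall>L. is_line L \<longrightarrow> 2 \<le> card (P - L)"
  then have "P - L \<noteq> {}" if "is_line L" for L using that by (metis card.empty not_numeral_le_zero)
  moreover have "card (P - L) \<noteq> 1" if "is_line L" for L using off that by fastforce
  ultimately show "\<not> collinear P \<and> \<not> near_pencil P"
    unfolding not_collinear_off near_pencil_def by blast
qed

text \<open>
  If \<open>r\<close> is the only point of \<open>R\<close> on \<open>L\<close>, then deleting \<open>r\<close> destroys the line \<open>L\<close>.
\<close>

lemma card_joins_delete:
  assumes fin: "finite R" "finite B" "R \<inter> B = {}" and L: "L \<in> joins R B" "card (L \<inter> R) < 2"
  obtains r where "r \<in> R" "card (joins (R - {r}) B) + 1 \<le> card (joins R B)"
proof -
  have "L \<inter> R \<noteq> {}" using L(1) by (auto simp: joins_def)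
  then have "card (L \<inter> R) = 1" using L(2) fin by (metis One_nat_def card_0_eq finite_Int less_2_cases)
  then obtain r where r: "L \<inter> R = {r}" by (auto simp: card_1_singleton_iff)
  have J: "finite (joins R B)" by (rule finite_joins[OF fin])
  have "joins (R - {r}) B \<subseteq> joins R B - {L}" using r by (auto simp: joins_def)
  then have "card (joins (R - {r}) B) \<le> card (joins R B - {L})" using J by (intro card_mono) auto
  moreover have "card (joins R B - {L}) = card (joins R B) - 1" "card (joins R B) > 0"
    using L(1) J by (auto simp: card_gt_0_iff)
  ultimately have "card (joins (R - {r}) B) + 1 \<le> card (joins R B)" by linarith
  then show ?thesis using that r by blast
qed

text \<open>
  A counterexample of least size is a \<open>tight_colouring\<close> after naming the more frequent colour red:
  deleting a point of this colour, or of either colour if both are equally frequent, leaves a smaller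
  instance.
\<close>

lemma card_joins_bound:
  fixes R B :: "(real^2) set"
  assumes "finite R" "finite B" "R \<inter> B = {}" "card R \<le> card B + 1" "card B \<le> card R + 1"
    and "\<And>L. is_line L \<Longrightarrow> 2 \<le> card ((R \<union> B) - L)"
  shows "card R + card B \<le> card (joins R B) + 1"
  using assms
proof (induction "card R + card B" arbitrary: R B rule: less_induct)
  case less
  have wlog: "card X + card Y \<le> card (joins X Y) + 1"
    if sum: "card X + card Y = card R + card B" and fin: "finite X" "finite Y" "X \<inter> Y = {}"
      and le: "card Y \<le> card X" "card X \<le> card Y + 1"
      and off2: "\<And>L. is_line L \<Longrightarrow> 2 \<le> card ((X \<union> Y) - L)" for X Y :: "(real^2) set"
  proof (rule ccontr)
    assume "\<not> ?thesis"
    then have few: "card (joins X Y) + 2 \<le> card X + card Y" by simp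
    let ?P = "X \<union> Y"
    have finP: "finite ?P" using fin by simp
    have cardP: "card ?P = card X + card Y" using fin by (simp add: card_Un_disjoint)
    obtain L0 :: "(real^2) set" where "is_line L0" using line_through_exists by metis
    from off2[OF this] have "2 \<le> card ?P"
      using card_mono[OF finP, of "?P - L0"] by auto
    then obtain p q where pq: "p \<in> ?P" "q \<in> ?P" "p \<noteq> q"
      using card_le_Suc0_iff_eq[OF finP] by fastforce
    have four: "4 \<le> card X + card Y"
    proof -
      let ?L = "affine hull {p, q}"
      have "2 \<le> card (?P - ?L)" by (rule off2[OF is_line_hull[OF pq(3)]])
      moreover have "card {p, q} \<le> card (?P \<inter> ?L)"
        using pq finP by (intro card_mono) (auto intro: hull_inc)
      moreover have "card {p, q} = 2" using pq by simp
      ultimately show ?thesis using card_Int_Diff[OF finP, of ?L] cardP by linarith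
    qed
    have off3: "3 \<le> card (?P - L)" if "is_line L" for L
    proof (rule ccontr)
      assume "\<not> ?thesis"
      then have "card (?P - L) = 2" using off2[OF that] by linarith
      then show False
        using two_points_off_line[OF fin that _ four] le few by simp
    qed
    have smaller: "card X' + card Y' \<le> card (joins X' Y') + 1"
      if "X' \<union> Y' = ?P - {r}" "r \<in> ?P" "X' \<subseteq> X" "Y' \<subseteq> Y" "card X' \<le> card Y' + 1" "card Y' \<le> card X' + 1"
      for X' Y' r
    proof (rule less.hyps)
      show "finite X'" "finite Y'" "X' \<inter> Y' = {}" using that fin finite_subset by blast+
      then have "card X' + card Y' = card (?P - {r})" using that(1) by (simp flip: card_Un_disjoint)
      also have "\<dots> < card ?P" using finP that(2) by (intro psubset_card_mono) auto
      finally show "card X' + card Y' < card R + card B" using cardP sum by simp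
      fix L :: "(real^2) set" assume "is_line L"
      then have "3 \<le> card (?P - L)" by (rule off3)
      also have "\<dots> \<le> card (insert r (?P - {r} - L))" using finP by (intro card_mono) auto
      also have "\<dots> \<le> Suc (card (?P - {r} - L))" by (rule card_insert_le_m1) simp_all
      finally show "2 \<le> card ((X' \<union> Y') - L)" unfolding that(1) by simp
    qed (use that in auto)
    have delX: "card X + card Y \<le> card (joins (X - {r}) Y) + 2" if "r \<in> X" for r
    proof -
      have "card (X - {r}) + card Y \<le> card (joins (X - {r}) Y) + 1"
        by (rule smaller[of _ _ r]) (use that fin le in auto)
      then show ?thesis using that fin by simp
    qed
    have delY: "card X + card Y \<le> card (joins X (Y - {r})) + 2" if "r \<in> Y" "card X = card Y" for r
    proof -
      have "card X + card (Y - {r}) \<le> card (joins X (Y - {r})) + 1"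
        by (rule smaller[of _ _ r]) (use that fin le in auto)
      then show ?thesis using that fin by simp
    qed
    have "tight_colouring X Y"
    proof
      show "\<not> collinear ?P" using card_off_ge2_iff[OF finP] off2 by blast
      have "X \<noteq> {}" using four le by auto
      then obtain r where r: "r \<in> X" by blast
      have "card (joins (X - {r}) Y) \<le> card (joins X Y)"
        using finite_joins[OF fin] joins_mono[of "X - {r}" X Y Y] by (intro card_mono) auto
      then show "card (joins X Y) + 2 = card X + card Y" using delX[OF r] few by linarith
    next
      fix L assume L: "L \<in> joins X Y"
      show "2 \<le> card (L \<inter> X)"
      proof (rule ccontr)
        assume "\<not> 2 \<le> card (L \<inter> X)"
        then obtain r where "r \<in> X" "card (joins (X - {r}) Y) + 1 \<le> card (joins X Y)"
          using card_joins_delete[OF fin L] by auto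
        then show False using delX[of r] few by linarith
      qed
      show "2 \<le> card (L \<inter> Y)" if "card X = card Y"
      proof (rule ccontr)
        assume "\<not> 2 \<le> card (L \<inter> Y)"
        then have "card (L \<inter> Y) < 2" by simp
        moreover have "Y \<inter> X = {}" using fin(3) by blast
        moreover have "L \<in> joins Y X" using L joins_commute by blast
        ultimately obtain r where r: "r \<in> Y" "card (joins (Y - {r}) X) + 1 \<le> card (joins Y X)"
          using card_joins_delete[OF fin(2,1)] by blast
        then have "card (joins X (Y - {r})) + 1 \<le> card (joins X Y)"
          using joins_commute[of X Y] joins_commute[of X "Y - {r}"] by argo
        then show False using delY[OF r(1) that] few by linarith
      qed
    qed (use fin le off3 in auto)
    then show False by (rule tight_colouring.contradiction)
  qed
  show ?case
  proof (cases "card B \<le> card R")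
    case True
    then show ?thesis using wlog[of R B] less.prems by simp
  next
    case False
    have "B \<inter> R = {}" using less.prems(3) by blast
    moreover have "2 \<le> card ((B \<union> R) - L)" if "is_line L" for L
      using less.prems(6)[OF that] by (simp only: Un_commute[of B R])
    moreover have "card R \<le> card B" "card B + card R = card R + card B" using False by simp_all
    ultimately have "card B + card R \<le> card (joins B R) + 1"
      using wlog[OF _ less.prems(2,1) _ _ less.prems(5)] by blast
    then show ?thesis using joins_commute[of R B] by (simp only: add.commute[of "card R"])
  qed
qed

theorem theorem5:
  fixes n :: nat and R B P :: "(real^2) set"
  assumes "n \<ge> 1"
    and "finite R" and "finite B" and "R \<inter> B = {}"
    and "P = R \<union> B"
    and "card R = n"
    and "card B = n \<or> card B = n - 1"
    and "\<not> collinear P"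
    and "\<not> near_pencil P"
  shows "card {L. determined_by P L \<and> bichromatic R B L} \<ge> card P - 1"
proof -
  have "{L. determined_by P L \<and> bichromatic R B L} = joins R B"
  proof (intro equalityI subsetI)
    fix L assume "L \<in> joins R B"
    then obtain x y where "is_line L" "x \<in> R" "x \<in> L" "y \<in> B" "y \<in> L" by (auto simp: joins_def)
    moreover from this have "x \<noteq> y" using assms(4) by blast
    ultimately show "L \<in> {L. determined_by P L \<and> bichromatic R B L}"
      unfolding determined_by_def bichromatic_def assms(5) by blast
  qed (auto simp: bichromatic_def joins_def)
  moreover have "card R + card B \<le> card (joins R B) + 1"
  proof (rule card_joins_bound)
    show "2 \<le> card ((R \<union> B) - L)" if "is_line L" for L
      using card_off_ge2_iff[of "R \<union> B"] assms that by blast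
  qed (use assms in auto)
  moreover have "card P = card R + card B"
    using assms by (simp add: card_Un_disjoint)
  ultimately show ?thesis by simp
qed

end
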